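(* Let $m\in\mathbb{Z}$ and let a flat bundle $H^{bun}_{\mathbb C}\to\mathbb{C}^*$ (complexification of a flat real bundle) with monodromy with eigenvalues in $S^1$, and corresponding forms $S$, $L^{nor}$, $P$, be given as in the context; let $H^\infty$ be the space of its flat multivalued global sections. (a) Let $\tau$ and $z$ both be coordinates on $\mathbb{C}$. For $\alpha>0$ and $A\in H^\infty_{e^{-2\pi i\alpha}}$, the Fourier–Laplace transformation $FL$ with $$FL(es(A,\alpha-1)(\tau))(z):=\int_0^{\infty\cdot z}e^{-\tau/z}\cdot es(A,\alpha-1)(\tau)\,d\tau$$ is well defined and maps the elementary section $es(A,\alpha-1)(\tau)$ in $\tau$ to an elementary section in $z$, namely $$FL(es(A,\alpha-1)(\tau))(z)=es(G^{(\alpha)}A,\alpha)(z).$$ (b) For $0<\alpha<1$ and $A\in H^\infty_{e^{-2\pi i\alpha}}$, $B\in H^\infty_{e^{2\pi i\alpha}}$, $$P\bigl(es(G^{(\alpha)}A,\alpha)(z),es(G^{(1-\alpha)}B,1-\alpha)(-z)\bigr)=\frac z{(2\pi i)^{m+1}}e^{\pi i(1-\alpha)}L^{nor}\bigl(G^{(\alpha)}A(\log z),e^{-N/2}G^{(1-\alpha)}B(\log z)\bigr)=\frac z{(2\pi i)^m}S(A,B).$$ For $A,B\in H^\infty_1$, $$P\bigl(es(G^{(1)}A,1)(z),es(G^{(1)}B,1)(-z)\bigr)=\frac{-z^2}{(2\pi i)^{m+1}}L^{nor}\bigl(G^{(1)}A(\log z),e^{-N/2}G^{(1)}B(\log z)\bigr)=\frac{-z^2}{(2\pi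 i)^{m+1}}S(A,B).$$
   Context: Data: a flat real vector bundle $H^{bun}_{\mathbb R}\to\mathbb{C}^*$ of finite rank whose monodromy $M$ (flat shift once around $0$ in the positive direction) has eigenvalues in $S^1$; $M=M_sM_u=M_uM_s$ (semisimple, unipotent), $N=\log M_u$, all acting flatly on fibers and on flat multivalued sections. On fibers there is a flat (i.e. compatible with parallel transport, in particular $M$-invariant) nondegenerate bilinear form $S$ which is $(-1)^m$-symmetric on the part $\bigoplus_{\lambda\ne1}\ker(M_s-\lambda)$ and $(-1)^{m+1}$-symmetric on $\ker(M_s-\mathrm{id})$. $L^{nor}(a,b):=-S(a,\nu^{-1}b)$ with $\nu=\frac1{M-\mathrm{id}}$ on the generalized eigenspaces with eigenvalue $\ne1$ and $\nu=\frac{-N}{M-\mathrm{id}}$ on the generalized eigenspace with eigenvalue $1$ (there $\frac{N}{M-\mathrm{id}}$ is the inverse of $\sum_{k\ge1}\frac1{k!}N^{k-1}$). Then $L^{nor}((-1)^{m+1}Ma,b)=L^{nor}(b,a)$. The pairing $P:H^{bun}_{z}\times H^{bun}_{-z}\to\mathbb{C}$, $z\in\mathbb{C}^*$, is $P(a,b)=\frac1{(2\pi i)^{m+1}}L^{nor}(a,\gamma_{-\pi}b)$, where $\gamma_{-\pi}:H^{bun}_{-z}\to H^{bun}_z$ is the flat shift by angle $\pi$ in the mathematically negative direction. All forms are extended $\mathbb{C}$-bilinearly. $H^\infty$ is the complex vector space of flat multivalued global sections $A(\log\tau)$ ($A(\xi)$ lies in the fiber over $\tau=e^\xi$); $H^\infty_\lambda=\ker(M_s-\lambda\,\mathrm{id})\subset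 H^\infty$. $S(A,B)$ and $L^{nor}(A,B)$ for flat sections mean the (constant) value on $A(\xi),B(\xi)$. For $A\in H^\infty_\lambda$ and $\alpha\in\mathbb{R}$ with $e^{-2\pi i\alpha}=\lambda$, the elementary section is the univalued holomorphic section $es(A,\alpha)(\tau)=e^{\log\tau(\alpha-\frac N{2\pi i})}A(\log\tau)$ on $\mathbb{C}^*$. For $\alpha>0$, $G^{(\alpha)}=\Gamma(\alpha\,\mathrm{id}-\frac N{2\pi i})=\sum_{k\ge0}\frac1{k!}\Gamma^{(k)}(\alpha)\left(\frac{-N}{2\pi i}\right)^k$ on $H^\infty_{e^{-2\pi i\alpha}}$. In $FL$, $\tau$ runs along the ray from $0$ through $z$, and the values of the section on this ray are identified with the fiber over $z$ by flat parallel transport along the ray. *)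

theory Defs
  imports "HOL-Complex_Analysis.Complex_Analysis"
begin

section \<open>Complexification\<close>

definition Re_vec :: "complex^'n \<Rightarrow> real^'n" where
  "Re_vec a = (\<chi> i. Re (a $ i))"

definition Im_vec :: "complex^'n \<Rightarrow> real^'n" where
  "Im_vec a = (\<chi> i. Im (a $ i))"

definition cx_map :: "(real^'n \<Rightarrow> real^'n) \<Rightarrow> complex^'n \<Rightarrow> complex^'n" where
  "cx_map f a = (\<chi> i. Complex (f (Re_vec a) $ i) (f (Im_vec a) $ i))"

definition cx_form :: "(real^'n \<Rightarrow> real^'n \<Rightarrow> real) \<Rightarrow> complex^'n \<Rightarrow> complex^'n \<Rightarrow> complex" where
  "cx_form s a b =
     Complex (s (Re_vec a) (Re_vec b) - s (Im_vec a) (Im_vec b))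
             (s (Re_vec a) (Im_vec b) + s (Im_vec a) (Re_vec b))"

section \<open>Endomorphisms of a complex vector space\<close>

text \<open>
  Scalar multiplication on \<^typ>\<open>complex^'n\<close> is \<^term>\<open>(*s)\<close>; the \<^term>\<open>vec.span\<close> used below is the
  complex span. The power series are applied to a vector and summed in \<^typ>\<open>complex^'n\<close>.
  Except in \<open>op_exp\<close>, whose series always converges, they are only used for nilpotent
  arguments, where they are finite sums.
\<close>

abbreviation clinear :: "(complex^'n \<Rightarrow> complex^'n) \<Rightarrow> bool" where
  "clinear \<equiv> Vector_Spaces.linear (*s) (*s)"

definition eigenspace :: "(complex^'n \<Rightarrow> complex^'n) \<Rightarrow> complex \<Rightarrow> (complex^'n) set" where
  "eigenspace f c = {v. f v = c *s v}"

definition gen_eigenspace :: "(complex^'n \<Rightarrow> complex^'n) \<Rightarrow> complex \<Rightarrow> (complex^'n) set" where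
  "gen_eigenspace f c = {v. \<exists>k. ((\<lambda>w. f w - c *s w) ^^ k) v = 0}"

definition semisimple :: "(complex^'n \<Rightarrow> complex^'n) \<Rightarrow> bool" where
  "semisimple f \<longleftrightarrow> clinear f \<and> vec.span (\<Union>c. eigenspace f c) = UNIV"

definition unipotent :: "(complex^'n \<Rightarrow> complex^'n) \<Rightarrow> bool" where
  "unipotent f \<longleftrightarrow> clinear f \<and> (\<exists>k. \<forall>v. ((\<lambda>w. f w - w) ^^ k) v = 0)"

definition jordan_parts ::
  "(complex^'n \<Rightarrow> complex^'n) \<Rightarrow> (complex^'n \<Rightarrow> complex^'n) \<Rightarrow> (complex^'n \<Rightarrow> complex^'n) \<Rightarrow> bool" where
  "jordan_parts f fs fu \<longleftrightarrow>
     semisimple fs \<and> unipotent fu \<and> f = fs \<circ> fu \<and> f = fu \<circ> fs"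

definition op_exp :: "(complex^'n \<Rightarrow> complex^'n) \<Rightarrow> complex^'n \<Rightarrow> complex^'n" where
  "op_exp X v = (\<Sum>k. (1 / fact k) *s (X ^^ k) v)"

definition op_log :: "(complex^'n \<Rightarrow> complex^'n) \<Rightarrow> complex^'n \<Rightarrow> complex^'n" where
  "op_log u v = (\<Sum>k. ((-1) ^ k / of_nat (Suc k)) *s ((\<lambda>w. u w - w) ^^ Suc k) v)"

text \<open>The series \<open>\<Sum>\<^sub>k\<^sub>\<ge>\<^sub>1 N^(k-1) / k!\<close>, that is, \<open>(exp N - id) / N\<close>.\<close>

definition op_expm1_div :: "(complex^'n \<Rightarrow> complex^'n) \<Rightarrow> complex^'n \<Rightarrow> complex^'n" where
  "op_expm1_div N v = (\<Sum>k. (1 / fact (Suc k)) *s (N ^^ k) v)"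

text \<open>\<open>\<Gamma>(\<alpha> id - N / (2 \<pi> i))\<close>, by Taylor expansion at \<open>\<alpha>\<close>.\<close>

definition op_Gamma :: "real \<Rightarrow> (complex^'n \<Rightarrow> complex^'n) \<Rightarrow> complex^'n \<Rightarrow> complex^'n" where
  "op_Gamma \<alpha> N v =
     (\<Sum>k. ((deriv ^^ k) Gamma (complex_of_real \<alpha>) / fact k) *s
           ((\<lambda>w. (- 1 / (2 * of_real pi * \<i>)) *s N w) ^^ k) v)"

section \<open>Flat bundles on the punctured plane\<close>

text \<open>
  A flat real bundle is given by its parallel transport: every fibre is identified with
  \<^typ>\<open>real^'n\<close> by the (arbitrary, pointwise) choice of a basis, and \<open>T p\<close> is the transport along
  the path \<open>p\<close>, from the fibre over \<open>pathstart p\<close> to the fibre over \<open>pathfinish p\<close>.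
  No compatibility between the chosen bases is required.
\<close>

definition flat_bundle :: "((real \<Rightarrow> complex) \<Rightarrow> real^'n \<Rightarrow> real^'n) \<Rightarrow> bool" where
  "flat_bundle T \<longleftrightarrow>
     (\<forall>p. path p \<and> path_image p \<subseteq> -{0} \<longrightarrow> linear (T p)) \<and>
     (\<forall>z. z \<noteq> 0 \<longrightarrow> T (linepath z z) = id) \<and>
     (\<forall>p q. path p \<and> path q \<and> path_image p \<subseteq> -{0} \<and> path_image q \<subseteq> -{0} \<and>
            pathfinish p = pathstart q \<longrightarrow> T (p +++ q) = T q \<circ> T p) \<and>
     (\<forall>p q. homotopic_paths (-{0}) p q \<longrightarrow> T p = T q)"

definition rotation_path :: "complex \<Rightarrow> real \<Rightarrow> real \<Rightarrow> complex" where
  "rotation_path z \<theta> = (\<lambda>t. z * exp (\<i> * of_real (\<theta> * t)))"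

definition flat_shift ::
  "((real \<Rightarrow> complex) \<Rightarrow> real^'n \<Rightarrow> real^'n) \<Rightarrow> complex \<Rightarrow> real \<Rightarrow> complex^'n \<Rightarrow> complex^'n" where
  "flat_shift T z \<theta> = cx_map (T (rotation_path z \<theta>))"

definition monodromy ::
  "((real \<Rightarrow> complex) \<Rightarrow> real^'n \<Rightarrow> real^'n) \<Rightarrow> complex \<Rightarrow> complex^'n \<Rightarrow> complex^'n" where
  "monodromy T z = flat_shift T z (2 * pi)"

text \<open>
  A multivalued section is a function of \<open>\<xi> = log \<tau>\<close> with \<open>A \<xi>\<close> in the complexified fibre over
  \<open>exp \<xi>\<close>.
\<close>

definition flat_sections ::
  "((real \<Rightarrow> complex) \<Rightarrow> real^'n \<Rightarrow> real^'n) \<Rightarrow> (complex \<Rightarrow> complex^'n) set" where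
  "flat_sections T =
     {A. \<forall>p. path p \<longrightarrow> A (pathfinish p) = cx_map (T (exp \<circ> p)) (A (pathstart p))}"

text \<open>A family of fibre endomorphisms acts pointwise on multivalued sections.\<close>

definition on_sections ::
  "(complex \<Rightarrow> complex^'n \<Rightarrow> complex^'n) \<Rightarrow> (complex \<Rightarrow> complex^'n) \<Rightarrow> complex \<Rightarrow> complex^'n" where
  "on_sections F A = (\<lambda>\<xi>. F (exp \<xi>) (A \<xi>))"

definition H_inf ::
  "((real \<Rightarrow> complex) \<Rightarrow> real^'n \<Rightarrow> real^'n) \<Rightarrow> (complex \<Rightarrow> complex^'n \<Rightarrow> complex^'n) \<Rightarrow> complex
     \<Rightarrow> (complex \<Rightarrow> complex^'n) set" where
  "H_inf T Ms c = {A \<in> flat_sections T. on_sections Ms A = (\<lambda>\<xi>. c *s A \<xi>)}"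

definition G_sec ::
  "(complex \<Rightarrow> complex^'n \<Rightarrow> complex^'n) \<Rightarrow> real \<Rightarrow> (complex \<Rightarrow> complex^'n) \<Rightarrow> complex \<Rightarrow> complex^'n"
where
  "G_sec N \<alpha> = on_sections (\<lambda>z. op_Gamma \<alpha> (N z))"

section \<open>The forms\<close>

text \<open>The form \<open>S\<close> on the real fibres; \<open>Ms\<close> is the semisimple part of the monodromy.\<close>

definition flat_form ::
  "((real \<Rightarrow> complex) \<Rightarrow> real^'n \<Rightarrow> real^'n) \<Rightarrow> (complex \<Rightarrow> complex^'n \<Rightarrow> complex^'n) \<Rightarrow> int
     \<Rightarrow> (complex \<Rightarrow> real^'n \<Rightarrow> real^'n \<Rightarrow> real) \<Rightarrow> bool" where
  "flat_form T Ms m S \<longleftrightarrow>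
     (\<forall>z. z \<noteq> 0 \<longrightarrow> bilinear (S z)) \<and>
     (\<forall>z a. z \<noteq> 0 \<and> (\<forall>b. S z a b = 0) \<longrightarrow> a = 0) \<and>
     (\<forall>p a b. path p \<and> path_image p \<subseteq> -{0} \<longrightarrow>
        S (pathfinish p) (T p a) (T p b) = S (pathstart p) a b) \<and>
     (\<forall>z. z \<noteq> 0 \<longrightarrow>
        (\<forall>a \<in> vec.span (\<Union>c\<in>-{1}. eigenspace (Ms z) c).
         \<forall>b \<in> vec.span (\<Union>c\<in>-{1}. eigenspace (Ms z) c).
           cx_form (S z) a b = (-1) powi m * cx_form (S z) b a)) \<and>
     (\<forall>z. z \<noteq> 0 \<longrightarrow>
        (\<forall>a \<in> eigenspace (Ms z) 1. \<forall>b \<in> eigenspace (Ms z) 1.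
           cx_form (S z) a b = (-1) powi (m + 1) * cx_form (S z) b a))"

definition form_on_sections ::
  "(complex \<Rightarrow> real^'n \<Rightarrow> real^'n \<Rightarrow> real) \<Rightarrow> (complex \<Rightarrow> complex^'n) \<Rightarrow> (complex \<Rightarrow> complex^'n)
     \<Rightarrow> complex" where
  "form_on_sections S A B = (THE c. \<forall>\<xi>. cx_form (S (exp \<xi>)) (A \<xi>) (B \<xi>) = c)"

text \<open>
  \<open>\<nu>\<close> is \<open>1 / (M - id)\<close> on the generalized eigenspaces of \<open>M\<close> with eigenvalue different from 1,
  and minus the inverse of \<^term>\<open>op_expm1_div N\<close> on the one with eigenvalue 1. Since
  \<open>M - id\<close> and \<^term>\<open>op_expm1_div N\<close>, respectively, restrict to automorphisms of these spaces,
  this determines \<open>\<nu>\<close> uniquely.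
\<close>

definition is_nu ::
  "(complex^'n \<Rightarrow> complex^'n) \<Rightarrow> (complex^'n \<Rightarrow> complex^'n) \<Rightarrow> (complex^'n \<Rightarrow> complex^'n) \<Rightarrow> bool" where
  "is_nu M N \<nu> \<longleftrightarrow>
     clinear \<nu> \<and>
     (\<forall>c v. c \<noteq> 1 \<and> v \<in> gen_eigenspace M c \<longrightarrow> \<nu> (M v - v) = v) \<and>
     (\<forall>v \<in> gen_eigenspace M 1. \<nu> (op_expm1_div N v) = - v)"

definition L_nor ::
  "(complex \<Rightarrow> real^'n \<Rightarrow> real^'n \<Rightarrow> real) \<Rightarrow> (complex \<Rightarrow> complex^'n \<Rightarrow> complex^'n)
     \<Rightarrow> complex \<Rightarrow> complex^'n \<Rightarrow> complex^'n \<Rightarrow> complex" where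
  "L_nor S \<nu> z a b = - cx_form (S z) a (inv (\<nu> z) b)"

text \<open>\<open>P_pair T S \<nu> m z\<close> pairs the fibre over \<open>z\<close> with the fibre over \<open>-z\<close>.\<close>

definition P_pair ::
  "((real \<Rightarrow> complex) \<Rightarrow> real^'n \<Rightarrow> real^'n) \<Rightarrow> (complex \<Rightarrow> real^'n \<Rightarrow> real^'n \<Rightarrow> real)
     \<Rightarrow> (complex \<Rightarrow> complex^'n \<Rightarrow> complex^'n) \<Rightarrow> int
     \<Rightarrow> complex \<Rightarrow> complex^'n \<Rightarrow> complex^'n \<Rightarrow> complex" where
  "P_pair T S \<nu> m z a b =
     1 / (2 * of_real pi * \<i>) powi (m + 1) * L_nor S \<nu> z a (flat_shift T (-z) (-pi) b)"

section \<open>Elementary sections and the Fourier-Laplace transformation\<close>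

text \<open>
  For \<open>A\<close> in the eigenspace for \<open>exp (- 2 \<pi> i \<alpha>)\<close> the value does not depend on the branch of the
  logarithm, so that the principal branch can be used.
\<close>

definition es ::
  "(complex \<Rightarrow> complex^'n \<Rightarrow> complex^'n) \<Rightarrow> (complex \<Rightarrow> complex^'n) \<Rightarrow> real \<Rightarrow> complex \<Rightarrow> complex^'n"
where
  "es N A \<alpha> \<tau> =
     op_exp (\<lambda>v. Ln \<tau> *s (of_real \<alpha> *s v - (1 / (2 * of_real pi * \<i>)) *s N \<tau> v)) (A (Ln \<tau>))"

text \<open>
  The integral along the ray through \<open>z\<close>, parametrized by \<open>\<tau> = t z\<close> with \<open>t > 0\<close>, so that
  \<open>d\<tau> = z dt\<close>.
\<close>

definition FL_integrand ::
  "((real \<Rightarrow> complex) \<Rightarrow> real^'n \<Rightarrow> real^'n) \<Rightarrow> (complex \<Rightarrow> complex^'n) \<Rightarrow> complex \<Rightarrow> real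
     \<Rightarrow> complex^'n" where
  "FL_integrand T f z t =
     (let \<tau> = of_real t * z in (exp (- \<tau> / z) * z) *s cx_map (T (linepath \<tau> z)) (f \<tau>))"

definition FL ::
  "((real \<Rightarrow> complex) \<Rightarrow> real^'n \<Rightarrow> real^'n) \<Rightarrow> (complex \<Rightarrow> complex^'n) \<Rightarrow> complex \<Rightarrow> complex^'n" where
  "FL T f z = (LINT t:{0<..}|lborel. FL_integrand T f z t)"

end

theory Submission
  imports Defs
begin

text \<open>
  Everything is a computation with power series in one nilpotent operator. On the fibre over
  \<open>z\<close>, the logarithm \<open>N\<close> of the unipotent part of the monodromy is nilpotent, so that every formal
  power series \<open>F\<close> has a value \<open>F(N)\<close> (\<open>fps_op\<close>), and \<open>F \<mapsto> F(N)\<close> respects products and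
  compositions. The exponentials, the operators \<open>G\<^bsup>(\<alpha>)\<^esup>\<close>, the factor \<open>exp(-N/2)\<close> and, on an eigenspace
  of the semisimple part, the inverse of \<open>\<nu>\<close> are all of this form. Hence the operator identities
  needed below reduce to identities between power series, and these follow from identities between
  holomorphic functions of one variable near \<open>0\<close>.

  Flatness is obtained as follows. Let \<open>A\<close> be a flat section in the eigenspace of the semisimple part
  with eigenvalue \<open>c\<close>. The monodromy acts by \<open>\<xi> \<mapsto> \<xi> + 2 \<pi> i\<close>, so the unipotent part sends \<open>A\<close> to the
  section \<open>\<xi> \<mapsto> c\<^bsup>-1\<^esup> A(\<xi> + 2 \<pi> i)\<close>, which is flat again and has the same eigenvalue. The unipotent part
  thus preserves \<open>H_inf T Ms c\<close>, and with it every \<open>F(N)\<close> does (\<open>on_sections_NF\<close>).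

  For part (a), transport along the ray turns the integrand into
  \<open>e\<^bsup>-t\<^esup> t\<^bsup>\<alpha>-1\<^esup> exp(-log t N / (2 \<pi> i))\<close>, applied to a vector that does not depend on \<open>t\<close>. This is a finite sum
  over \<open>k\<close> with coefficients \<open>e\<^bsup>-t\<^esup> t\<^bsup>\<alpha>-1\<^esup> (log t)\<^sup>k\<close>. Their integrals are the derivatives of \<open>\<Gamma>\<close> at \<open>\<alpha>\<close>
  (\<open>Gamma_higher_deriv_integral\<close>), and the sum is the Taylor expansion that defines \<open>G\<^bsup>(\<alpha>)\<^esup>\<close>.

  For part (b), \<open>S\<close> is invariant under the monodromy, so on eigenspaces with inverse eigenvalues
  \<open>N\<close> is skew, that is \<open>S(F(N) a, b) = S(a, F(-N) b)\<close> (\<open>S_NF_adjoint\<close>). The factors \<open>exp(-\<zeta> N / (2 \<pi> i))\<close>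
  of the two elementary sections therefore cancel. What remains are scalars and a factor
  \<open>exp(-N/2)\<close>, the effect of the half turn \<open>\<gamma>\<^bsub>-\<pi>\<^esub>\<close> (\<open>P_pair_es\<close>). Moving the first \<open>\<Gamma>\<close>-operator to the
  second argument leaves \<open>\<Gamma>(\<alpha> + w) \<Gamma>(\<beta> - w) exp(-N/2) h(N)\<close> with \<open>w = N / (2 \<pi> i)\<close> and \<open>\<nu>\<^bsup>-1\<^esup> = h(N)\<close>.
  By Euler's reflection formula this is a scalar (\<open>Gamma_fps_reflection\<close>,
  \<open>Gamma_fps_reflection_1\<close>).
\<close>

section \<open>Power series in a nilpotent operator\<close>

definition nilpotent_op :: "(complex^'n \<Rightarrow> complex^'n) \<Rightarrow> bool" where
  "nilpotent_op X \<longleftrightarrow> clinear X \<and> (\<exists>K. \<forall>v. (X ^^ K) v = 0)"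

text \<open>
  The value of a formal power series at an operator. It is meant for nilpotent operators, for which
  the series is a finite sum.
\<close>

definition fps_op :: "complex fps \<Rightarrow> (complex^'n \<Rightarrow> complex^'n) \<Rightarrow> complex^'n \<Rightarrow> complex^'n" where
  "fps_op F X v = (\<Sum>k. fps_nth F k *s (X ^^ k) v)"

lemma clinear_funpow: "clinear X \<Longrightarrow> clinear (X ^^ k)"
proof (induction k)
  case 0 show ?case using vec.linear_id by (simp add: id_def)
next
  case (Suc k) then show ?case using Vector_Spaces.linear_compose[of "(*s)" "(*s)" "X ^^ k" "(*s)" X] by (simp add: o_def)
qed

lemma funpow_eq_0_mono:
  assumes "clinear X" "(X ^^ K) v = 0" "K \<le> k"
  shows "(X ^^ k) v = 0"
proof -
  have "(X ^^ k) v = (X ^^ (k - K)) ((X ^^ K) v)"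
    using assms(3) by (metis funpow_add le_add_diff_inverse2 o_apply)
  then show ?thesis using assms vec.linear_0[OF clinear_funpow] by simp
qed

lemma fps_op_eq_sum:
  assumes "clinear X" "(X ^^ K) v = 0"
  shows "fps_op F X v = (\<Sum>k<K. fps_nth F k *s (X ^^ k) v)"
  unfolding fps_op_def
  by (rule suminf_finite) (use funpow_eq_0_mono[OF assms] in auto)

lemma nilpotent_op_clinear: "nilpotent_op X \<Longrightarrow> clinear X"
  by (simp add: nilpotent_op_def)

lemma nilpotent_opE:
  assumes "nilpotent_op X"
  obtains K where "\<And>v. (X ^^ K) v = 0" "\<And>F v. fps_op F X v = (\<Sum>k<K. fps_nth F k *s (X ^^ k) v)"
proof -
  from assms obtain K where "clinear X" and z: "\<And>v. (X ^^ K) v = 0"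
    unfolding nilpotent_op_def by blast
  then show thesis by (intro that[of K] fps_op_eq_sum)
qed

lemma clinear_sum_scaled:
  assumes "\<And>i. i \<in> I \<Longrightarrow> clinear (f i)"
  shows "clinear (\<lambda>v. \<Sum>i\<in>I. c i *s f i v)"
  by (intro vec.linear_compose_sum ballI vec.linear_compose_scale_right assms)

lemma clinear_fps_op:
  assumes "nilpotent_op X"
  shows "clinear (fps_op F X)"
proof -
  obtain K where K: "\<And>F v. fps_op F X v = (\<Sum>k<K. fps_nth F k *s (X ^^ k) v)"
    by (rule nilpotent_opE[OF assms], rule that)
  show ?thesis unfolding K[abs_def]
    by (intro clinear_sum_scaled clinear_funpow nilpotent_op_clinear assms)
qed

lemma fps_op_const_mult:
  assumes "nilpotent_op X"
  shows "fps_op (fps_const c * F) X v = c *s fps_op F X v"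
  by (rule nilpotent_opE[OF assms]) (simp add: vec.scale_sum_right)

lemma fps_op_const [simp]: "fps_op (fps_const c) X v = c *s v"
proof -
  have "fps_op (fps_const c) X v = (\<Sum>k\<in>{0}. fps_nth (fps_const c) k *s (X ^^ k) v)"
    unfolding fps_op_def by (rule suminf_finite) auto
  then show ?thesis by simp
qed

lemma fps_op_0 [simp]: "fps_op 0 X v = 0"
  using fps_op_const[of 0 X v] by simp

lemma fps_op_1 [simp]: "fps_op 1 X v = v"
  using fps_op_const[of 1 X v] by simp

lemma fps_op_fps_X [simp]: "fps_op fps_X X v = X v"
proof -
  have "fps_op fps_X X v = (\<Sum>k\<in>{1}. fps_nth fps_X k *s (X ^^ k) v)"
    unfolding fps_op_def by (rule suminf_finite) auto
  then show ?thesis by simp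
qed

lemma fps_op_diff:
  assumes "nilpotent_op X"
  shows "fps_op (F - G) X v = fps_op F X v - fps_op G X v"
  by (rule nilpotent_opE[OF assms]) (simp add: vec.scale_left_diff_distrib sum_subtractf)

text \<open>
  Both sides are sums over the pairs \<open>(i, j)\<close> of exponents, the left one over a triangle and the right one
  over a square; they agree because the terms with \<open>i + j \<ge> K\<close> vanish if \<open>X\<^sup>K = 0\<close>.
\<close>

lemma fps_op_mult:
  assumes X: "nilpotent_op X"
  shows "fps_op (F * G) X v = fps_op F X (fps_op G X v)"
proof -
  obtain K where z: "\<And>v. (X ^^ K) v = 0"
    and K: "\<And>F v. fps_op F X v = (\<Sum>k<K. fps_nth F k *s (X ^^ k) v)"
    by (rule nilpotent_opE[OF X], rule that)
  note lin = nilpotent_op_clinear[OF X]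
  define t where "t i j = (fps_nth F i * fps_nth G j) *s (X ^^ (i + j)) v" for i j
  have t0: "t i j = 0" if "\<not> i + j < K" for i j
    using funpow_eq_0_mono[OF lin z, of "i + j" v] that by (simp add: t_def)
  have "fps_op (F * G) X v = (\<Sum>k<K. \<Sum>i\<le>k. t i (k - i))"
    unfolding K by (simp add: fps_mult_nth vec.scale_sum_left t_def atLeast0AtMost)
  also have "\<dots> = (\<Sum>(i, j)\<in>{(i, j). i + j < K}. t i j)"
    by (rule sum.triangle_reindex[symmetric])
  also have "\<dots> = (\<Sum>(i, j)\<in>{..<K} \<times> {..<K}. t i j)"
    by (rule sum.mono_neutral_left) (use t0 in auto)
  also have "\<dots> = (\<Sum>i<K. \<Sum>j<K. t i j)"
    by (simp add: sum.cartesian_product)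
  also have "\<dots> = fps_op F X (fps_op G X v)"
    unfolding K t_def
    by (simp add: vec.linear_sum[OF clinear_funpow[OF lin]] vec.linear_scale[OF clinear_funpow[OF lin]]
        vec.scale_sum_right funpow_add)
  finally show ?thesis .
qed

lemma fps_op_power:
  assumes "nilpotent_op X"
  shows "fps_op (G ^ k) X v = ((fps_op G X) ^^ k) v"
  by (induction k) (simp_all add: fps_op_mult[OF assms])

lemma nilpotent_op_fps_op:
  assumes X: "nilpotent_op X" and G: "fps_nth G 0 = 0"
  shows "nilpotent_op (fps_op G X)"
proof -
  obtain K where K: "\<And>F v. fps_op F X v = (\<Sum>k<K. fps_nth F k *s (X ^^ k) v)"
    by (rule nilpotent_opE[OF X], rule that)
  have "fps_op (G ^ K) X v = 0" for v
    unfolding K using startsby_zero_power_prefix[OF G, of K] by simp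
  then show ?thesis
    unfolding nilpotent_op_def using clinear_fps_op[OF X] fps_op_power[OF X] by metis
qed

text \<open>
  If \<open>G\<close> has no constant term, the coefficients of \<open>G\<^sup>i\<close> below \<open>i\<close> vanish. So both sides only involve
  exponents below the order of nilpotency of \<open>X\<close>, and the claim is an exchange of two finite sums.
\<close>

lemma fps_op_compose:
  assumes X: "nilpotent_op X" and G: "fps_nth G 0 = 0"
  shows "fps_op (F oo G) X v = fps_op F (fps_op G X) v"
proof -
  obtain K where K: "\<And>F v. fps_op F X v = (\<Sum>k<K. fps_nth F k *s (X ^^ k) v)"
    by (rule nilpotent_opE[OF X], rule that)
  have z: "fps_op (G ^ K) X v = 0"
    unfolding K using startsby_zero_power_prefix[OF G, of K] by simp
  have co: "fps_nth (F oo G) j = (\<Sum>i<K. fps_nth F i * fps_nth (G ^ i) j)" if "j < K" for j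
    unfolding fps_compose_nth
    by (rule sum.mono_neutral_left) (use that startsby_zero_power_prefix[OF G] in auto)
  have "fps_op (F oo G) X v = (\<Sum>j<K. \<Sum>i<K. (fps_nth F i * fps_nth (G ^ i) j) *s (X ^^ j) v)"
    unfolding K by (rule sum.cong) (simp_all add: co vec.scale_sum_left)
  also have "\<dots> = (\<Sum>i<K. \<Sum>j<K. (fps_nth F i * fps_nth (G ^ i) j) *s (X ^^ j) v)"
    by (rule sum.swap)
  also have "\<dots> = (\<Sum>i<K. fps_nth F i *s fps_op (G ^ i) X v)"
    unfolding K by (simp add: vec.scale_sum_right)
  also have "\<dots> = fps_op F (fps_op G X) v"
    using fps_op_eq_sum[OF clinear_fps_op[OF X], of K G v F] z
    by (simp add: fps_op_power[OF X])
  finally show ?thesis .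
qed

lemma fps_op_linear:
  assumes "nilpotent_op X"
  shows "fps_op (fps_const c * fps_X) X = (\<lambda>v. c *s X v)"
  by (rule ext) (simp add: fps_op_const_mult[OF assms])

lemma fps_op_scaled:
  assumes X: "nilpotent_op X"
  shows "fps_op F (\<lambda>v. c *s X v) v = fps_op (F oo (fps_const c * fps_X)) X v"
  by (simp only: fps_op_linear[OF X, symmetric]) (simp add: fps_op_compose[OF X])

lemma nilpotent_op_scaled:
  assumes X: "nilpotent_op X"
  shows "nilpotent_op (\<lambda>v. c *s X v)"
  by (simp only: fps_op_linear[OF X, symmetric]) (simp add: nilpotent_op_fps_op[OF X])

lemma op_exp_eq_fps_op: "op_exp X = fps_op (fps_exp 1) X"
  by (simp add: fun_eq_iff op_exp_def fps_op_def)

lemma op_expm1_div_eq_fps_op: "op_expm1_div X = fps_op (Abs_fps (\<lambda>k. 1 / fact (Suc k))) X"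
  by (simp add: fun_eq_iff op_expm1_div_def fps_op_def)

lemma op_Gamma_eq_fps_op:
  assumes "nilpotent_op X"
  shows "op_Gamma \<alpha> X =
    fps_op (fps_expansion Gamma (of_real \<alpha>) oo (fps_const (- 1 / (2 * of_real pi * \<i>)) * fps_X)) X"
  by (rule ext, subst fps_op_scaled[OF assms, symmetric])
     (simp add: op_Gamma_def fps_op_def fps_expansion_def)

lemma clinear_minus_id: "clinear u \<Longrightarrow> clinear (\<lambda>w. u w - w)"
  by (intro vec.linear_compose_sub vec.linear_ident)

lemma unipotent_minus_id: "unipotent u \<Longrightarrow> nilpotent_op (\<lambda>w. u w - w)"
  unfolding unipotent_def nilpotent_op_def using clinear_minus_id by blast

lemma op_log_eq_fps_op:
  assumes "unipotent u"
  shows "op_log u = fps_op (fps_ln 1) (\<lambda>w. u w - w)"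
proof
  fix v
  note Y = unipotent_minus_id[OF assms]
  obtain K where z: "\<And>v. ((\<lambda>w. u w - w) ^^ K) v = 0"
    by (rule nilpotent_opE[OF Y], rule that)
  note lin = nilpotent_op_clinear[OF Y]
  have "op_log u v = (\<Sum>k<K. ((-1) ^ k / of_nat (Suc k)) *s ((\<lambda>w. u w - w) ^^ Suc k) v)"
    unfolding op_log_def
    by (rule suminf_finite) (simp_all add: funpow_eq_0_mono[OF lin z] del: funpow.simps)
  also have "\<dots> = (\<Sum>k<Suc K. fps_nth (fps_ln 1) k *s ((\<lambda>w. u w - w) ^^ k) v)"
    by (subst sum.lessThan_Suc_shift) (simp add: fps_ln_nth)
  also have "\<dots> = fps_op (fps_ln 1) (\<lambda>w. u w - w) v"
    by (rule fps_op_eq_sum[OF lin, symmetric]) (simp add: funpow_eq_0_mono[OF lin z] del: funpow.simps)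
  finally show "op_log u v = fps_op (fps_ln 1) (\<lambda>w. u w - w) v" .
qed

lemma nilpotent_op_log: "unipotent u \<Longrightarrow> nilpotent_op (op_log u)"
  by (simp add: op_log_eq_fps_op nilpotent_op_fps_op unipotent_minus_id)

text \<open>
  The exponential and logarithmic series are mutually inverse under composition.
\<close>

lemma fps_op_exp_log:
  assumes "unipotent u"
  shows "fps_op (fps_exp 1) (op_log u) v = u v"
proof -
  note Y = unipotent_minus_id[OF assms]
  have "fps_op (fps_exp 1 - 1) (op_log u) v = fps_op ((fps_exp 1 - 1) oo fps_ln 1) (\<lambda>w. u w - w) v"
    unfolding op_log_eq_fps_op[OF assms] by (simp add: fps_op_compose[OF Y])
  also have "\<dots> = u v - v"
    using fps_inv_fps_exp_compose(2)[of "1::complex"] by (simp add: fps_ln_fps_exp_inv)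
  finally show ?thesis by (simp add: fps_op_diff[OF nilpotent_op_log[OF assms]])
qed

lemma binomial_op:
  assumes "clinear X"
  shows "((\<lambda>v. a *s v + X v) ^^ k) v = (\<Sum>i\<le>k. (of_nat (k choose i) * a ^ (k - i)) *s (X ^^ i) v)"
proof (induction k arbitrary: v)
  case (Suc k)
  have X1: "X (\<Sum>i\<le>k. c i *s (X ^^ i) v) = (\<Sum>i\<le>k. c i *s (X ^^ Suc i) v)" for c
    using assms by (simp add: vec.linear_sum vec.linear_scale)
  have "((\<lambda>v. a *s v + X v) ^^ Suc k) v =
      a *s (\<Sum>i\<le>k. (of_nat (k choose i) * a ^ (k - i)) *s (X ^^ i) v) +
      (\<Sum>i\<le>k. (of_nat (k choose i) * a ^ (k - i)) *s (X ^^ Suc i) v)"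
    by (simp only: funpow.simps o_apply Suc.IH X1)
  also have "a *s (\<Sum>i\<le>k. (of_nat (k choose i) * a ^ (k - i)) *s (X ^^ i) v) =
     (\<Sum>i\<le>k. (of_nat (k choose i) * a ^ (Suc k - i)) *s (X ^^ i) v)"
    by (simp add: vec.scale_sum_right Suc_diff_le mult_ac)
  also have "\<dots> = a ^ Suc k *s v + (\<Sum>i\<le>k. (of_nat (k choose Suc i) * a ^ (k - i)) *s (X ^^ Suc i) v)"
  proof -
    have "(\<Sum>i\<le>k. (of_nat (k choose i) * a ^ (Suc k - i)) *s (X ^^ i) v) =
      (\<Sum>i\<le>Suc k. (of_nat (k choose i) * a ^ (Suc k - i)) *s (X ^^ i) v)" by simp
    also have "\<dots> = a ^ Suc k *s v + (\<Sum>i\<le>k. (of_nat (k choose Suc i) * a ^ (k - i)) *s (X ^^ Suc i) v)"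
      by (subst sum.atMost_Suc_shift) simp
    finally show ?thesis .
  qed
  finally show ?case
    by (subst sum.atMost_Suc_shift)
       (simp add: vec.scale_left_distrib sum.distrib algebra_simps)
qed simp

text \<open>
  The operator \<open>a + X\<close> is not nilpotent, so its exponential is an infinite series. By the
  binomial formula it is, in each coordinate, the Cauchy product of the series of \<open>e\<^sup>a\<close> and the
  finite series of \<open>e\<^sup>X\<close>.
\<close>

lemma op_exp_scalar_plus_nilpotent:
  assumes X: "nilpotent_op X"
  shows "op_exp (\<lambda>v. a *s v + X v) v = exp a *s op_exp X v"
proof -
  obtain K where z: "\<And>v. (X ^^ K) v = 0"
    by (rule nilpotent_opE[OF X], rule that)
  note lin = nilpotent_op_clinear[OF X]
  have z': "(X ^^ i) v = 0" if "K \<le> i" for i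
    using funpow_eq_0_mono[OF lin z that] .
  define b where "b i l = (1 / fact i) * ((X ^^ i) v $ l)" for i l
  have bs: "(\<lambda>i. b i l) sums (op_exp X v $ l)" for l
  proof -
    have "op_exp X v = (\<Sum>k<K. (1 / fact k) *s (X ^^ k) v)"
      unfolding op_exp_def by (rule suminf_finite) (use z' in auto)
    then have "op_exp X v $ l = (\<Sum>k<K. b k l)" by (simp add: b_def)
    moreover have "(\<lambda>i. b i l) sums (\<Sum>k<K. b k l)"
      by (rule sums_finite) (use z' in \<open>auto simp: b_def\<close>)
    ultimately show ?thesis by simp
  qed
  have bn: "summable (\<lambda>i. norm (b i l))" for l
    by (rule summable_finite[of "{..<K}"]) (use z' in \<open>auto simp: b_def\<close>)
  have comp: "((1 / fact k) *s ((\<lambda>v. a *s v + X v) ^^ k) v) $ l =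
      (\<Sum>i\<le>k. b i l * (a ^ (k - i) /\<^sub>R fact (k - i)))" for k l
  proof -
    have "((1 / fact k) *s ((\<lambda>v. a *s v + X v) ^^ k) v) $ l =
        (\<Sum>i\<le>k. 1 / fact k * (of_nat (k choose i) * a ^ (k - i) * ((X ^^ i) v $ l)))"
      by (simp add: binomial_op[OF lin] sum_distrib_left)
    also have "\<dots> = (\<Sum>i\<le>k. b i l * (a ^ (k - i) /\<^sub>R fact (k - i)))"
      by (rule sum.cong) (simp_all add: b_def binomial_fact scaleR_conv_of_real field_simps)
    finally show ?thesis .
  qed
  have "(\<lambda>k. ((1 / fact k) *s ((\<lambda>v. a *s v + X v) ^^ k) v) $ l) sums ((exp a *s op_exp X v) $ l)" for l
    unfolding comp
    using Cauchy_product_sums[OF bn[of l] summable_norm_exp[of a]] bs[of l]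
    by (simp add: sums_iff exp_def mult.commute)
  then have "(\<lambda>k. (1 / fact k) *s ((\<lambda>v. a *s v + X v) ^^ k) v) sums (exp a *s op_exp X v)"
    unfolding sums_def by (intro vec_tendstoI) (simp add: sum_component)
  then show ?thesis unfolding op_exp_def[of "\<lambda>v. a *s v + X v"] by (simp add: sums_iff)
qed

section \<open>Derivatives of the Gamma function and the reflection formula\<close>

lemma analytic_Gamma_pos:
  assumes "\<alpha> > 0"
  shows "Gamma analytic_on {complex_of_real \<alpha>}"
proof (rule analytic_Gamma)
  have False if "complex_of_real \<alpha> \<in> \<int>\<^sub>\<le>\<^sub>0"
  proof -
    from that obtain n where "complex_of_real \<alpha> = of_int n" "n \<le> 0"
      by (rule nonpos_Ints_cases)
    then have "\<alpha> = of_int n" by (metis Re_complex_of_real of_real_of_int_eq)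
    then show False using assms \<open>n \<le> 0\<close> by simp
  qed
  then show "{complex_of_real \<alpha>} \<inter> \<int>\<^sub>\<le>\<^sub>0 = {}" by blast
qed

lemma Gamma_integrand_lborel:
  assumes w: "Re w > 0"
  shows "set_integrable lborel {0<..} (\<lambda>t. of_real t powr (w - 1) / of_real (exp t))"
    and "(LINT t:{0<..}|lborel. of_real t powr (w - 1) / of_real (exp t)) = Gamma w"
proof -
  let ?f = "\<lambda>t. complex_of_real t powr (w - 1) / of_real (exp t)"
  have abs: "set_integrable lebesgue {0<..} ?f"
    using absolutely_integrable_Gamma_integral'[OF w] .
  have meas: "(\<lambda>t. indicator {0<..} t *\<^sub>R ?f t) \<in> borel_measurable lborel"
    by measurable
  show int: "set_integrable lborel {0<..} ?f"
    using abs integrable_completion[OF meas] by (simp add: set_integrable_def)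
  have "Gamma w = integral {0<..} ?f"
    using Gamma_integral_complex'[OF w] by (simp add: integral_unique)
  also have "\<dots> = (LINT t:{0<..}|lebesgue. ?f t)"
    by (rule set_lebesgue_integral_eq_integral(2)[OF abs, symmetric])
  also have "\<dots> = (LINT t:{0<..}|lborel. ?f t)"
    unfolding set_lebesgue_integral_def by (rule integral_completion[OF meas])
  finally show "(LINT t:{0<..}|lborel. ?f t) = Gamma w" ..
qed

text \<open>
  This bounds all powers of \<open>ln t\<close> at once by powers of \<open>t\<close> with small exponents, both for \<open>t \<rightarrow> 0\<close>
  and for \<open>t \<rightarrow> \<infinity>\<close>.
\<close>

lemma exp_abs_ln_le: "0 < t \<Longrightarrow> exp (r * \<bar>ln t\<bar>) \<le> t powr r + t powr (- r)" for t r :: real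
  by (auto simp: powr_def abs_if mult.commute)

lemma exp_partial_sum_le:
  fixes x :: real
  assumes "x \<ge> 0"
  shows "(\<Sum>k<n. x ^ k / fact k) \<le> exp x"
proof -
  have "summable (\<lambda>k. x ^ k / fact k)"
    using summable_exp_generic[of x] by (simp add: divide_inverse mult.commute)
  then have "(\<Sum>k<n. x ^ k / fact k) \<le> (\<Sum>k. x ^ k / fact k)"
    by (rule sum_le_suminf) (use assms in auto)
  then show ?thesis by (simp add: exp_def divide_inverse mult.commute)
qed

text \<open>
  For small \<open>w\<close>, expanding \<open>t\<^bsup>w\<^esup> = exp(w ln t)\<close> in Euler's integral for \<open>\<Gamma>(\<alpha> + w)\<close> and integrating term by
  term gives a power series in \<open>w\<close> whose coefficients are the integrals in question, divided by \<open>k!\<close>.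
  Uniqueness of the Taylor expansion identifies them with the derivatives. The interchange is justified by
  dominated convergence: for \<open>\<bar>w\<bar> \<le> r\<close> all partial sums are bounded by
  \<open>e\<^bsup>-t\<^esup> t\<^bsup>\<alpha>-1\<^esup> (t\<^bsup>r\<^esup> + t\<^bsup>-r\<^esup>)\<close>, which is integrable for \<open>0 < r < \<alpha>\<close>.
\<close>

lemma Gamma_higher_deriv_integral:
  assumes \<alpha>: "\<alpha> > 0"
  shows "set_integrable lborel {0<..} (\<lambda>t. complex_of_real (exp (- t) * t powr (\<alpha> - 1) * ln t ^ k))"
      (is "?int k")
    and "(LINT t:{0<..}|lborel. complex_of_real (exp (- t) * t powr (\<alpha> - 1) * ln t ^ k)) =
           (deriv ^^ k) Gamma (complex_of_real \<alpha>)"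
proof -
  define f where "f k t = exp (- t) * t powr (\<alpha> - 1) * ln t ^ k" for k and t :: real
  define r where "r = \<alpha> / 2"
  have r: "r > 0" "r < \<alpha>" using \<alpha> by (auto simp: r_def)
  \<comment> \<open>bounds the partial sums of the series for all small \<open>w\<close> at once\<close>
  define D where "D t = indicator {0<..} t * (exp (- t) * t powr (\<alpha> - 1) * (t powr r + t powr (- r)))"
    for t :: real
  have intreal: "set_integrable lborel {0<..} (\<lambda>t. exp (- t) * t powr (\<beta> - 1))" if "\<beta> > 0" for \<beta> :: real
  proof -
    have "set_integrable lborel {0<..} (\<lambda>t. norm (of_real t powr (of_real \<beta> - 1) / of_real (exp t) :: complex))"
      by (rule set_integrable_norm, rule Gamma_integrand_lborel) (use that in simp)
    then show ?thesis
      by (rule set_integrable_cong[THEN iffD1, rotated -1])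
         (auto simp: norm_divide norm_powr_real_powr exp_minus field_simps)
  qed
  have intD: "integrable lborel D"
  proof -
    have "set_integrable lborel {0<..} (\<lambda>t. exp (- t) * t powr ((\<alpha> + r) - 1) + exp (- t) * t powr ((\<alpha> - r) - 1))"
      by (intro set_integral_add intreal) (use r \<alpha> in auto)
    then have "set_integrable lborel {0<..} (\<lambda>t. exp (- t) * t powr (\<alpha> - 1) * (t powr r + t powr (- r)))"
      by (rule set_integrable_cong[THEN iffD1, rotated -1])
         (auto simp: algebra_simps powr_add powr_diff powr_minus field_simps)
    then show ?thesis by (simp add: set_integrable_def D_def[abs_def])
  qed
  have partial: "(\<Sum>k<n. \<bar>f k t\<bar> * s ^ k / fact k) \<le> exp (- t) * t powr (\<alpha> - 1) * (t powr r + t powr (- r))"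
    if "t > 0" "0 \<le> s" "s \<le> r" for t s n
  proof -
    have "(\<Sum>k<n. \<bar>f k t\<bar> * s ^ k / fact k) = exp (- t) * t powr (\<alpha> - 1) * (\<Sum>k<n. (s * \<bar>ln t\<bar>) ^ k / fact k)"
      by (simp add: f_def sum_distrib_left abs_mult power_abs power_mult_distrib mult_ac)
    also have "(\<Sum>k<n. (s * \<bar>ln t\<bar>) ^ k / fact k) \<le> exp (s * \<bar>ln t\<bar>)"
      by (rule exp_partial_sum_le) (use that in auto)
    also have "exp (s * \<bar>ln t\<bar>) \<le> exp (r * \<bar>ln t\<bar>)"
      using that by (simp add: mult_right_mono)
    also have "\<dots> \<le> t powr r + t powr (- r)"
      using exp_abs_ln_le[OF that(1)] .
    finally show ?thesis by (simp add: mult_left_mono)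
  qed
  have fint: "set_integrable lborel {0<..} (\<lambda>t. complex_of_real (f k t))" for k
    unfolding set_integrable_def
  proof (rule Bochner_Integration.integrable_bound[OF integrable_mult_left[OF intD, of "fact k / r ^ k"]])
    show "(\<lambda>t. indicator {0<..} t *\<^sub>R complex_of_real (f k t)) \<in> borel_measurable lborel"
      unfolding f_def by measurable
    show "AE t in lborel. norm (indicator {0<..} t *\<^sub>R complex_of_real (f k t)) \<le> norm (D t * (fact k / r ^ k))"
    proof (rule AE_I2)
      fix t :: real
      show "norm (indicator {0<..} t *\<^sub>R complex_of_real (f k t)) \<le> norm (D t * (fact k / r ^ k))"
      proof (cases "t > 0")
        case True
        have "\<bar>f k t\<bar> * r ^ k / fact k \<le> (\<Sum>j<Suc k. \<bar>f j t\<bar> * r ^ j / fact j)"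
          using r by (simp add: sum_nonneg)
        also have "\<dots> \<le> D t" using partial[OF True, of r "Suc k"] True r by (simp add: D_def)
        finally have "\<bar>f k t\<bar> \<le> D t * (fact k / r ^ k)" using r by (simp add: field_simps)
        then have "\<bar>f k t\<bar> \<le> norm (D t * (fact k / r ^ k))"
          unfolding real_norm_def by (rule order_trans[OF _ abs_ge_self])
        then show ?thesis using True by simp
      qed simp
    qed
  qed
  then show "?int k" by (simp add: f_def)
  define c where "c k = (LINT t:{0<..}|lborel. complex_of_real (f k t))" for k
  have sums: "(\<lambda>k. (c k / fact k) * w ^ k) sums Gamma (of_real \<alpha> + w)" if w: "norm w \<le> r" for w
  proof -
    have Re: "Re (of_real \<alpha> + w) > 0"
      using w r abs_Re_le_cmod[of w] by auto
    let ?s = "\<lambda>n t. \<Sum>k<n. (w ^ k / fact k) * (indicator {0<..} t *\<^sub>R complex_of_real (f k t))"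
    let ?l = "\<lambda>t. indicator {0<..} t *\<^sub>R (complex_of_real t powr ((of_real \<alpha> + w) - 1) / of_real (exp t))"
    have "(\<lambda>n. integral\<^sup>L lborel (?s n)) \<longlonglongrightarrow> integral\<^sup>L lborel ?l"
    proof (rule integral_dominated_convergence[where w = D])
      show "?l \<in> borel_measurable lborel" by measurable
      show "?s n \<in> borel_measurable lborel" for n unfolding f_def by measurable
      show "integrable lborel D" by (rule intD)
      show "AE t in lborel. (\<lambda>n. ?s n t) \<longlonglongrightarrow> ?l t"
      proof (rule AE_I2)
        fix t :: real
        show "(\<lambda>n. ?s n t) \<longlonglongrightarrow> ?l t"
        proof (cases "t > 0")
          case True
          have "(\<lambda>k. of_real (exp (- t) * t powr (\<alpha> - 1)) * ((w * of_real (ln t)) ^ k /\<^sub>R fact k)) sums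
              (of_real (exp (- t) * t powr (\<alpha> - 1)) * exp (w * of_real (ln t)))"
            by (intro sums_mult exp_converges)
          also have "of_real (exp (- t) * t powr (\<alpha> - 1)) * exp (w * of_real (ln t)) = ?l t"
            using True by (simp add: powr_def exp_minus exp_add exp_diff exp_of_real Ln_of_real algebra_simps divide_simps flip: of_real_mult)
          also have "(\<lambda>k. of_real (exp (- t) * t powr (\<alpha> - 1)) * ((w * of_real (ln t)) ^ k /\<^sub>R fact k)) =
             (\<lambda>k. (w ^ k / fact k) * (indicator {0<..} t *\<^sub>R complex_of_real (f k t)))"
            using True by (simp add: fun_eq_iff f_def power_mult_distrib scaleR_conv_of_real field_simps)
          finally show ?thesis by (simp add: sums_def)
        qed simp
      qed
      show "AE t in lborel. norm (?s n t) \<le> D t" for n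
      proof (rule AE_I2)
        fix t :: real
        show "norm (?s n t) \<le> D t"
        proof (cases "t > 0")
          case True
          have "norm (?s n t) \<le> (\<Sum>k<n. norm ((w ^ k / fact k) * (indicator {0<..} t *\<^sub>R complex_of_real (f k t))))"
            by (rule norm_sum)
          also have "\<dots> = (\<Sum>k<n. \<bar>f k t\<bar> * norm w ^ k / fact k)"
            using True by (simp add: norm_mult norm_divide norm_power mult_ac)
          also have "\<dots> \<le> D t" using partial[OF True, of "norm w" n] True w by (simp add: D_def)
          finally show ?thesis .
        qed (simp add: D_def)
      qed
    qed
    moreover have "integral\<^sup>L lborel (?s n) = (\<Sum>k<n. (c k / fact k) * w ^ k)" for n
    proof -
      have "integral\<^sup>L lborel (?s n) =
          (\<Sum>k<n. integral\<^sup>L lborel (\<lambda>t. (w ^ k / fact k) * (indicator {0<..} t *\<^sub>R complex_of_real (f k t))))"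
        by (intro Bochner_Integration.integral_sum integrable_mult_right)
           (use fint in \<open>simp add: set_integrable_def\<close>)
      also have "\<dots> = (\<Sum>k<n. (w ^ k / fact k) * c k)"
        unfolding c_def set_lebesgue_integral_def by (simp only: integral_mult_right_zero)
      finally show ?thesis by (simp add: mult.commute)
    qed
    moreover have "integral\<^sup>L lborel ?l = Gamma (of_real \<alpha> + w)"
      using Gamma_integrand_lborel(2)[OF Re] by (simp add: set_lebesgue_integral_def)
    ultimately show ?thesis by (simp add: sums_def)
  qed
  let ?C = "Abs_fps (\<lambda>k. c k / fact k)"
  have "fps_conv_radius ?C \<ge> ereal r"
    unfolding fps_conv_radius_def using sums[of "of_real r"] r
    by (intro order_trans[OF _ conv_radius_geI[of _ "complex_of_real r"]]) (auto simp: sums_iff)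
  then have radius: "fps_conv_radius ?C > 0"
    using r by (auto intro: less_le_trans[of _ "ereal r"])
  have "(\<lambda>w. Gamma (of_real \<alpha> + w)) has_fps_expansion ?C"
    unfolding has_fps_expansion_def
  proof (intro conjI radius)
    have "\<forall>\<^sub>F w in nhds 0. w \<in> ball (0 :: complex) r"
      using r by (intro eventually_nhds_in_open) auto
    then show "\<forall>\<^sub>F w in nhds 0. eval_fps ?C w = Gamma (of_real \<alpha> + w)"
      by eventually_elim (use sums in \<open>auto simp: eval_fps_def sums_iff\<close>)
  qed
  moreover have "(\<lambda>w. Gamma (of_real \<alpha> + w)) has_fps_expansion fps_expansion Gamma (complex_of_real \<alpha>)"
    by (rule analytic_at_imp_has_fps_expansion[OF analytic_Gamma_pos[OF \<alpha>]])
  ultimately have "?C = fps_expansion Gamma (complex_of_real \<alpha>)"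
    by (rule fps_expansion_unique_complex)
  then have "fps_nth ?C k = fps_nth (fps_expansion Gamma (complex_of_real \<alpha>)) k" by simp
  then have "c k = (deriv ^^ k) Gamma (complex_of_real \<alpha>)"
    by (simp add: fps_expansion_def)
  then show "(LINT t:{0<..}|lborel. complex_of_real (exp (- t) * t powr (\<alpha> - 1) * ln t ^ k)) =
           (deriv ^^ k) Gamma (complex_of_real \<alpha>)"
    by (simp add: c_def f_def)
qed

text \<open>
  The Taylor expansion in \<open>n\<close> of \<open>\<Gamma>(\<alpha> - n / (2 \<pi> i))\<close>; its value at \<open>N\<close> is \<open>G\<^bsup>(\<alpha>)\<^esup>\<close>.
\<close>

definition Gamma_fps :: "real \<Rightarrow> complex fps" where
  "Gamma_fps \<alpha> = fps_expansion Gamma (of_real \<alpha>) oo (fps_const (- 1 / (2 * of_real pi * \<i>)) * fps_X)"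

lemma Gamma_fps_expansion:
  assumes "\<alpha> > 0"
  shows "(\<lambda>n. Gamma (of_real \<alpha> - n / (2 * of_real pi * \<i>))) has_fps_expansion Gamma_fps \<alpha>"
    and "(\<lambda>n. Gamma (of_real \<alpha> + n / (2 * of_real pi * \<i>))) has_fps_expansion (Gamma_fps \<alpha> oo (- fps_X))"
proof -
  have "(\<lambda>w. Gamma (of_real \<alpha> + w)) has_fps_expansion fps_expansion Gamma (complex_of_real \<alpha>)"
    by (rule analytic_at_imp_has_fps_expansion[OF analytic_Gamma_pos[OF assms]])
  from has_fps_expansion_compose[OF this has_fps_expansion_cmult_left[OF has_fps_expansion_fps_X,
      of "- 1 / (2 * of_real pi * \<i>)"]]
  show 1: "(\<lambda>n. Gamma (of_real \<alpha> - n / (2 * of_real pi * \<i>))) has_fps_expansion Gamma_fps \<alpha>"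
    by (simp add: o_def Gamma_fps_def)
  from has_fps_expansion_compose[OF 1 has_fps_expansion_minus[OF has_fps_expansion_fps_X]]
  show "(\<lambda>n. Gamma (of_real \<alpha> + n / (2 * of_real pi * \<i>))) has_fps_expansion (Gamma_fps \<alpha> oo (- fps_X))"
    by (simp add: o_def)
qed

text \<open>
  This is where \<open>exp(-N/2)\<close> and the factor \<open>M - id = \<nu>\<^bsup>-1\<^esup>\<close> meet: together they are the sine in the
  denominator of the reflection formula.
\<close>

lemma exp_half_sin:
  "exp (- n / 2) * (exp (2 * of_real pi * \<i> * a) * exp n - 1) =
     2 * \<i> * exp (of_real pi * \<i> * a) * sin (of_real pi * (a + n / (2 * of_real pi * \<i>)))"
proof -
  let ?x = "of_real pi * \<i> * a + n / 2"
  have "\<i> * (of_real pi * (a + n / (2 * of_real pi * \<i>))) = ?x"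
    by (simp add: field_simps)
  then have sin: "2 * \<i> * sin (of_real pi * (a + n / (2 * of_real pi * \<i>))) = exp ?x - exp (- ?x)"
    by (subst sin_exp_eq) (simp only:, simp)
  have e: "exp (of_real pi * \<i> * a) * exp ?x = exp (- n / 2) * (exp (2 * of_real pi * \<i> * a) * exp n)"
      "exp (of_real pi * \<i> * a) * exp (- ?x) = exp (- n / 2)"
    by (simp_all flip: exp_add add: field_simps)
  have "2 * \<i> * exp (of_real pi * \<i> * a) * sin (of_real pi * (a + n / (2 * of_real pi * \<i>))) =
      exp (of_real pi * \<i> * a) * (2 * \<i> * sin (of_real pi * (a + n / (2 * of_real pi * \<i>))))"
    by (simp only: mult_ac)
  also have "\<dots> = exp (- n / 2) * (exp (2 * of_real pi * \<i> * a) * exp n) - exp (- n / 2)"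
    unfolding sin right_diff_distrib e ..
  finally show ?thesis by (simp add: right_diff_distrib)
qed

lemma Gamma_fps_reflection:
  assumes \<alpha>: "0 < \<alpha>" "\<alpha> < 1"
  shows "(Gamma_fps \<alpha> oo (- fps_X)) *
     (Gamma_fps (1 - \<alpha>) * fps_exp (- 1 / 2) * (fps_const (exp (2 * of_real pi * \<i> * of_real \<alpha>)) * fps_exp 1 - 1)) =
     fps_const (2 * of_real pi * \<i> * exp (of_real pi * \<i> * of_real \<alpha>))" (is "?L = fps_const ?\<kappa>")
proof (rule fps_expansion_unique_complex)
  let ?a = "complex_of_real \<alpha>"
  let ?z = "\<lambda>n. ?a + n / (2 * of_real pi * \<i>)"
  let ?f = "\<lambda>n. Gamma (?z n) * (Gamma (of_real (1 - \<alpha>) - n / (2 * of_real pi * \<i>)) * exp (- 1 / 2 * n) *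
      (exp (2 * of_real pi * \<i> * ?a) * exp n - 1))"
  show f: "?f has_fps_expansion ?L"
    by (intro fps_expansion_intros Gamma_fps_expansion) (use \<alpha> in auto)
  have "sin (of_real pi * ?z 0) \<noteq> 0"
  proof -
    have "sin (pi * \<alpha>) > 0" using \<alpha> by (intro sin_gt_zero) auto
    moreover have "sin (of_real pi * ?z 0) = of_real (sin (pi * \<alpha>))"
      by (simp flip: of_real_mult add: sin_of_real)
    ultimately show ?thesis by simp
  qed
  then have "\<forall>\<^sub>F n in nhds 0. sin (of_real pi * ?z n) \<noteq> 0"
    by (rule tendsto_imp_eventually_ne[rotated]) (intro tendsto_intros filterlim_ident, simp)
  then have "\<forall>\<^sub>F n in nhds 0. ?f n = ?\<kappa>"
  proof eventually_elim
    case (elim n)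
    have "?f n = (Gamma (?z n) * Gamma (1 - ?z n)) *
        (exp (- n / 2) * (exp (2 * of_real pi * \<i> * ?a) * exp n - 1))"
      by (simp add: algebra_simps)
    also have "\<dots> = ?\<kappa>"
      unfolding exp_half_sin Gamma_reflection_complex using elim by simp
    finally show ?case .
  qed
  then have "?f has_fps_expansion fps_const ?\<kappa> \<longleftrightarrow> (\<lambda>n::complex. ?\<kappa>) has_fps_expansion fps_const ?\<kappa>"
    by (intro has_fps_expansion_cong) auto
  then show "?f has_fps_expansion fps_const ?\<kappa>" using has_fps_expansion_const by blast
qed

text \<open>
  The series \<open>\<Sum>\<^sub>k n\<^sup>k / (k + 1)!\<close> is \<open>(e\<^sup>n - 1) / n\<close>, so the claim is checked after multiplication by \<open>n\<close>. With
  \<open>w = n / (2 \<pi> i)\<close> it then follows from \<open>\<Gamma>(1 + w) \<Gamma>(1 - w) = w \<Gamma>(w) \<Gamma>(1 - w) = \<pi> w / sin (\<pi> w)\<close>.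
\<close>

lemma Gamma_fps_reflection_1:
  "(Gamma_fps 1 oo (- fps_X)) *
     (Gamma_fps 1 * fps_exp (- 1 / 2) * Abs_fps (\<lambda>k. 1 / fact (Suc k))) = 1" (is "?L * (?M * ?E) = 1")
proof -
  have E: "?E * fps_X = fps_exp 1 - 1"
    by (rule fps_ext) (auto simp: fps_X_mult_right_nth gr0_conv_Suc)
  have "?L * (?M * (fps_exp 1 - 1)) = fps_X"
  proof (rule fps_expansion_unique_complex)
    let ?w = "\<lambda>n. n / (2 * of_real pi * \<i>)"
    let ?f = "\<lambda>n. Gamma (of_real 1 + ?w n) * (Gamma (of_real 1 - ?w n) * exp (- 1 / 2 * n) * (exp n - 1))"
    show "?f has_fps_expansion ?L * (?M * (fps_exp 1 - 1))"
      by (intro fps_expansion_intros Gamma_fps_expansion) auto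
    \<comment> \<open>on this ball the only zero of the sine below is the origin\<close>
    have "\<forall>\<^sub>F n in nhds 0. n \<in> ball (0 :: complex) 1"
      by (intro eventually_nhds_in_open) auto
    then have "\<forall>\<^sub>F n in nhds 0. ?f n = n"
    proof eventually_elim
      case (elim n)
      show ?case
      proof (cases "n = 0")
        case False
        have nn: "norm (of_real pi * ?w n) < pi"
          using elim pi_gt3 by (simp add: norm_divide norm_mult)
        have sin: "sin (of_real pi * ?w n) \<noteq> 0"
        proof
          assume "sin (of_real pi * ?w n) = 0"
          then obtain k :: int where k: "of_real pi * ?w n = of_real (of_int k * pi)"
            unfolding sin_eq_0 by blast
          have "norm (complex_of_real (of_int k * pi)) < pi" using nn unfolding k .
          then have "\<bar>of_int k :: real\<bar> * pi < 1 * pi"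
            unfolding norm_of_real by (simp add: abs_mult del: mult_less_cancel_right)
          then have "k = 0" by (simp add: mult_less_cancel_right)
          with k False show False by simp
        qed
        have "?w n \<notin> \<int>\<^sub>\<le>\<^sub>0"
        proof
          assume "?w n \<in> \<int>\<^sub>\<le>\<^sub>0"
          then obtain k where "?w n = of_int k" by (rule nonpos_Ints_cases)
          then have "of_real pi * ?w n = of_real (of_int k * pi)" by simp
          then show False using sin unfolding sin_eq_0 by blast
        qed
        then have "Gamma (1 + ?w n) = ?w n * Gamma (?w n)"
          using Gamma_plus1[of "?w n"] by (simp add: add.commute)
        then have "?f n = ?w n * (Gamma (?w n) * Gamma (1 - ?w n)) * (exp (- n / 2) * (exp (2 * of_real pi * \<i> * 0) * exp n - 1))"
          by simp
        also have "\<dots> = ?w n * (2 * of_real pi * \<i>)"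
          unfolding exp_half_sin Gamma_reflection_complex add_0
          using nonzero_divide_eq_eq[OF sin, of "of_real pi", THEN iffD1, OF refl]
          by (simp del: times_divide_eq_left times_divide_eq_right)
        also have "\<dots> = n" by simp
        finally show ?thesis .
      qed simp
    qed
    then have "?f has_fps_expansion fps_X \<longleftrightarrow> (\<lambda>n::complex. n) has_fps_expansion fps_X"
      by (intro has_fps_expansion_cong) auto
    then show "?f has_fps_expansion fps_X" using has_fps_expansion_fps_X by blast
  qed
  then have "(?L * (?M * ?E)) * fps_X = 1 * fps_X"
    by (simp only: E[symmetric] mult.assoc mult_1)
  then show ?thesis by (rule mult_right_cancel[THEN iffD1, rotated]) simp
qed

section \<open>Flat multivalued sections\<close>

lemma Re_Im_vec_add:
  "Re_vec (a + b) = Re_vec a + Re_vec b" "Im_vec (a + b) = Im_vec a + Im_vec b"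
  by (simp_all add: Re_vec_def Im_vec_def vec_eq_iff)

lemma Re_Im_vec_scale:
  "Re_vec (c *s a) = Re c *\<^sub>R Re_vec a - Im c *\<^sub>R Im_vec a"
  "Im_vec (c *s a) = Re c *\<^sub>R Im_vec a + Im c *\<^sub>R Re_vec a"
  by (simp_all add: Re_vec_def Im_vec_def vec_eq_iff)

lemma cx_map_clinear:
  assumes "linear f"
  shows "clinear (cx_map f)"
proof -
  interpret f: linear f by fact
  show ?thesis
    unfolding Vector_Spaces.linear_iff
    by (intro conjI allI vec.vector_space_axioms)
       (simp_all add: cx_map_def Re_Im_vec_add Re_Im_vec_scale f.add f.diff f.scale vec_eq_iff complex_eq_iff)
qed

lemma fps_op_subspace:
  assumes "nilpotent_op X" "vec.subspace V" "\<And>v. v \<in> V \<Longrightarrow> X v \<in> V" "v \<in> V"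
  shows "fps_op F X v \<in> V"
proof -
  have "(X ^^ k) v \<in> V" for k using assms(3,4) by (induction k) auto
  moreover obtain K where "fps_op F X v = (\<Sum>k<K. fps_nth F k *s (X ^^ k) v)"
    by (rule nilpotent_opE[OF assms(1)], rule that)
  ultimately show ?thesis
    by (simp add: vec.subspace_sum vec.subspace_scale assms(2))
qed

lemma subspace_eigenspace: "clinear f \<Longrightarrow> vec.subspace (eigenspace f c)"
  by (auto simp: vec.subspace_def eigenspace_def vec.linear_0 vec.linear_add vec.linear_scale
      vec.scale_right_distrib mult.commute)

lemma path_exp_comp: "path p \<Longrightarrow> path (exp \<circ> p) \<and> path_image (exp \<circ> p) \<subseteq> - {0}" for p :: "real \<Rightarrow> complex"
  by (intro conjI path_continuous_image continuous_intros) (auto simp: path_image_def)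

lemma rotation_path_exp: "rotation_path (exp \<xi>) \<theta> = exp \<circ> linepath \<xi> (\<xi> + \<i> * of_real \<theta>)"
  by (simp add: rotation_path_def fun_eq_iff linepath_def scaleR_conv_of_real algebra_simps flip: exp_add)

text \<open>
  The Jordan decomposition of the monodromy is given fibre by fibre. That functions of \<open>N\<close> map flat
  sections in \<open>H_inf T Ms c\<close> to flat sections is \<open>on_sections_NF\<close> below.
\<close>

locale flat_bundle_jordan =
  fixes T :: "(real \<Rightarrow> complex) \<Rightarrow> real^'n \<Rightarrow> real^'n"
    and Ms Mu :: "complex \<Rightarrow> complex^'n \<Rightarrow> complex^'n"
  assumes flat: "flat_bundle T"
    and jordan: "\<And>z. z \<noteq> 0 \<Longrightarrow> jordan_parts (monodromy T z) (Ms z) (Mu z)"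
begin

abbreviation N :: "complex \<Rightarrow> complex^'n \<Rightarrow> complex^'n" where
  "N \<equiv> \<lambda>z. op_log (Mu z)"

text \<open>
  \<open>NF F z\<close> is \<open>F(N)\<close> on the fibre over \<open>z\<close>.
\<close>

abbreviation NF :: "complex fps \<Rightarrow> complex \<Rightarrow> complex^'n \<Rightarrow> complex^'n" where
  "NF F \<equiv> \<lambda>z. fps_op F (N z)"

lemma Ms_clinear: "z \<noteq> 0 \<Longrightarrow> clinear (Ms z)"
  using jordan by (auto simp: jordan_parts_def semisimple_def)

lemma Mu_unipotent: "z \<noteq> 0 \<Longrightarrow> unipotent (Mu z)"
  using jordan by (auto simp: jordan_parts_def)

lemma Mu_clinear: "z \<noteq> 0 \<Longrightarrow> clinear (Mu z)"
  using Mu_unipotent by (auto simp: unipotent_def)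

lemma nilpotent_N: "z \<noteq> 0 \<Longrightarrow> nilpotent_op (N z)"
  by (rule nilpotent_op_log[OF Mu_unipotent])

lemma Mu_eq_exp_N: "z \<noteq> 0 \<Longrightarrow> Mu z v = NF (fps_exp 1) z v"
  by (rule fps_op_exp_log[OF Mu_unipotent, symmetric])

lemma monodromy_eq1: "z \<noteq> 0 \<Longrightarrow> monodromy T z v = Mu z (Ms z v)"
proof -
  assume "z \<noteq> 0"
  then have "monodromy T z = Mu z \<circ> Ms z" using jordan unfolding jordan_parts_def by blast
  then show ?thesis by simp
qed

lemma monodromy_eq2: "z \<noteq> 0 \<Longrightarrow> monodromy T z v = Ms z (Mu z v)"
proof -
  assume "z \<noteq> 0"
  then have "monodromy T z = Ms z \<circ> Mu z" using jordan unfolding jordan_parts_def by blast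
  then show ?thesis by simp
qed

lemma monodromy_eigenspace:
  assumes "z \<noteq> 0" "v \<in> eigenspace (Ms z) c"
  shows "monodromy T z v = c *s NF (fps_exp 1) z v"
proof -
  have "monodromy T z v = Mu z (Ms z v)"
    by (simp add: monodromy_eq1[OF assms(1)])
  then show ?thesis
    using assms by (simp add: eigenspace_def vec.linear_scale[OF Mu_clinear] flip: Mu_eq_exp_N)
qed

lemma Mu_eigenspace:
  assumes "z \<noteq> 0" "v \<in> eigenspace (Ms z) c"
  shows "Mu z v \<in> eigenspace (Ms z) c"
proof -
  have "Ms z (Mu z v) = Mu z (Ms z v)"
    by (metis monodromy_eq1[OF assms(1)] monodromy_eq2[OF assms(1)])
  then show ?thesis using assms by (simp add: eigenspace_def vec.linear_scale[OF Mu_clinear])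
qed

lemma NF_eigenspace:
  assumes "z \<noteq> 0" "v \<in> eigenspace (Ms z) c"
  shows "NF F z v \<in> eigenspace (Ms z) c"
proof (rule fps_op_subspace[OF nilpotent_N[OF assms(1)] subspace_eigenspace[OF Ms_clinear[OF assms(1)]] _ assms(2)])
  fix v assume v: "v \<in> eigenspace (Ms z) c"
  show "N z v \<in> eigenspace (Ms z) c"
    unfolding op_log_eq_fps_op[OF Mu_unipotent[OF assms(1)]]
    by (rule fps_op_subspace[OF unipotent_minus_id[OF Mu_unipotent[OF assms(1)]]
          subspace_eigenspace[OF Ms_clinear[OF assms(1)]] _ v])
       (intro vec.subspace_diff subspace_eigenspace Ms_clinear assms(1) Mu_eigenspace)
qed

text \<open>
  On the eigenspace of the semisimple part, \<open>M - c = c (M\<^sub>u - 1)\<close>, which is nilpotent.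
\<close>

lemma eigenspace_subset_gen_eigenspace:
  assumes z: "z \<noteq> 0"
  shows "eigenspace (Ms z) c \<subseteq> gen_eigenspace (monodromy T z) c"
proof
  fix v assume v: "v \<in> eigenspace (Ms z) c"
  let ?Y = "\<lambda>w. Mu z w - w"
  note Y = unipotent_minus_id[OF Mu_unipotent[OF z]]
  have "((\<lambda>w. monodromy T z w - c *s w) ^^ k) v = c ^ k *s (?Y ^^ k) v \<and> (?Y ^^ k) v \<in> eigenspace (Ms z) c" for k
  proof (induction k)
    case (Suc k)
    let ?u = "(?Y ^^ k) v"
    have u: "?u \<in> eigenspace (Ms z) c" using Suc by blast
    have in_E: "c ^ k *s ?u \<in> eigenspace (Ms z) c"
      by (intro vec.subspace_scale subspace_eigenspace Ms_clinear z u)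
    have "monodromy T z (c ^ k *s ?u) - c *s (c ^ k *s ?u) = c ^ Suc k *s ?Y ?u"
      using monodromy_eigenspace[OF z in_E] vec.linear_scale[OF Mu_clinear[OF z]]
      by (simp add: vec.scale_right_diff_distrib flip: Mu_eq_exp_N[OF z])
    moreover have "?Y ?u \<in> eigenspace (Ms z) c"
      by (intro vec.subspace_diff subspace_eigenspace Ms_clinear z Mu_eigenspace u)
    ultimately show ?case using Suc by simp
  qed (use v in auto)
  moreover obtain K where "(?Y ^^ K) v = 0" by (rule nilpotent_opE[OF Y], rule that)
  ultimately have "((\<lambda>w. monodromy T z w - c *s w) ^^ K) v = 0" by simp
  then show "v \<in> gen_eigenspace (monodromy T z) c" unfolding gen_eigenspace_def by blast
qed

lemma transport_clinear: "path p \<Longrightarrow> clinear (cx_map (T (exp \<circ> p)))"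
  using flat path_exp_comp[of p] by (intro cx_map_clinear) (auto simp: flat_bundle_def)

lemma flat_sectionD:
  "A \<in> flat_sections T \<Longrightarrow> path p \<Longrightarrow> cx_map (T (exp \<circ> p)) (A (pathstart p)) = A (pathfinish p)"
  by (simp add: flat_sections_def)

text \<open>
  The circular path through \<open>e\<^sup>\<xi>\<close> is the exponential of a line segment, so that the rotation of a
  flat section is a shift of its argument.
\<close>

lemma flat_shift_flat_section:
  assumes "A \<in> flat_sections T"
  shows "flat_shift T (exp \<xi>) \<theta> (A \<xi>) = A (\<xi> + \<i> * of_real \<theta>)"
proof -
  show ?thesis
    using flat_sectionD[OF assms, of "linepath \<xi> (\<xi> + \<i> * of_real \<theta>)"]
    by (simp add: flat_shift_def rotation_path_exp)
qed

lemma H_inf_flat: "A \<in> H_inf T Ms c \<Longrightarrow> A \<in> flat_sections T"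
  by (simp add: H_inf_def)

lemma H_inf_eigenspace: "A \<in> H_inf T Ms c \<Longrightarrow> A \<xi> \<in> eigenspace (Ms (exp \<xi>)) c"
  by (auto simp: H_inf_def on_sections_def eigenspace_def fun_eq_iff)

lemma H_infI:
  assumes "\<And>p. path p \<Longrightarrow> cx_map (T (exp \<circ> p)) (A (pathstart p)) = A (pathfinish p)"
    and "\<And>\<xi>. A \<xi> \<in> eigenspace (Ms (exp \<xi>)) c"
  shows "A \<in> H_inf T Ms c"
  using assms by (auto simp: H_inf_def flat_sections_def on_sections_def eigenspace_def)

lemma monodromy_H_inf:
  assumes "A \<in> H_inf T Ms c"
  shows "A (\<xi> + 2 * of_real pi * \<i>) = c *s NF (fps_exp 1) (exp \<xi>) (A \<xi>)"
  using flat_shift_flat_section[OF H_inf_flat[OF assms], of \<xi> "2 * pi"]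
    monodromy_eigenspace[OF _ H_inf_eigenspace[OF assms]]
  by (simp add: monodromy_def mult_ac)

text \<open>
  The number of terms in the finite sum may depend on the fibre. For flatness along a path it is
  enough to choose it large enough for the two end points.
\<close>

lemma on_sections_fps_op:
  assumes nil: "\<And>z. z \<noteq> 0 \<Longrightarrow> nilpotent_op (X z)"
    and pres: "\<And>A. A \<in> H_inf T Ms c \<Longrightarrow> on_sections X A \<in> H_inf T Ms c"
    and A: "A \<in> H_inf T Ms c"
  shows "on_sections (\<lambda>z. fps_op F (X z)) A \<in> H_inf T Ms c"
proof (rule H_infI)
  have pow: "(\<lambda>\<xi>. (X (exp \<xi>) ^^ k) (A \<xi>)) \<in> H_inf T Ms c" for k
  proof (induction k)
    case (Suc k) then show ?case using pres by (fastforce simp: on_sections_def)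
  qed (use A in simp)
  have cl: "clinear (X (exp \<xi>))" for \<xi> using nilpotent_op_clinear[OF nil] by simp
  have ev: "\<exists>K. (X (exp \<xi>) ^^ K) (A \<xi>) = 0" for \<xi>
    using nil[of "exp \<xi>"] by (auto simp: nilpotent_op_def)
  show "cx_map (T (exp \<circ> p)) (on_sections (\<lambda>z. fps_op F (X z)) A (pathstart p)) =
      on_sections (\<lambda>z. fps_op F (X z)) A (pathfinish p)" if p: "path p" for p
  proof -
    obtain K1 K2 where "(X (exp (pathstart p)) ^^ K1) (A (pathstart p)) = 0"
      "(X (exp (pathfinish p)) ^^ K2) (A (pathfinish p)) = 0" using ev by blast
    then have K: "(X (exp (pathstart p)) ^^ max K1 K2) (A (pathstart p)) = 0"
      "(X (exp (pathfinish p)) ^^ max K1 K2) (A (pathfinish p)) = 0"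
      using funpow_eq_0_mono[OF cl] by (metis max.cobounded1 max.cobounded2)+
    note tr = transport_clinear[OF p]
    show ?thesis
      unfolding on_sections_def fps_op_eq_sum[OF cl K(1)] fps_op_eq_sum[OF cl K(2)]
        vec.linear_sum[OF tr] vec.linear_scale[OF tr]
      by (rule sum.cong) (use flat_sectionD[OF H_inf_flat[OF pow] p] in auto)
  qed
  show "on_sections (\<lambda>z. fps_op F (X z)) A \<xi> \<in> eigenspace (Ms (exp \<xi>)) c" for \<xi>
  proof -
    obtain K where K: "(X (exp \<xi>) ^^ K) (A \<xi>) = 0" using ev by blast
    show ?thesis
      unfolding on_sections_def fps_op_eq_sum[OF cl K]
      by (intro vec.subspace_sum vec.subspace_scale subspace_eigenspace Ms_clinear exp_not_eq_zero
          H_inf_eigenspace[OF pow])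
  qed
qed

text \<open>
  For \<open>A\<close> in \<open>H_inf T Ms c\<close> the unipotent part of the monodromy acts as \<open>A \<mapsto> c\<^bsup>-1\<^esup> A(\<sqdot> + 2 \<pi> i)\<close>, which commutes
  with parallel transport since \<open>exp\<close> has period \<open>2 \<pi> i\<close>. Then \<open>N\<close> and \<open>F(N)\<close> preserve \<open>H_inf T Ms c\<close> as power
  series in operators that do.
\<close>

lemma on_sections_NF:
  assumes c: "c \<noteq> 0" and A: "A \<in> H_inf T Ms c"
  shows "on_sections (NF F) A \<in> H_inf T Ms c"
proof (rule on_sections_fps_op[OF nilpotent_N _ A])
  fix A assume A: "A \<in> H_inf T Ms c"
  have Mu: "on_sections (\<lambda>z w. Mu z w - w) A \<in> H_inf T Ms c" if A: "A \<in> H_inf T Ms c" for A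
  proof (rule H_infI)
    have eq: "Mu (exp \<xi>) (A \<xi>) = (1 / c) *s A (\<xi> + 2 * of_real pi * \<i>)" for \<xi>
      using c by (simp add: monodromy_H_inf[OF A] Mu_eq_exp_N)
    fix p :: "real \<Rightarrow> complex" assume p: "path p"
    define q where "q = (\<lambda>t. p t + 2 * of_real pi * \<i>)"
    have q: "path q" "exp \<circ> q = exp \<circ> p" "pathstart q = pathstart p + 2 * of_real pi * \<i>"
      "pathfinish q = pathfinish p + 2 * of_real pi * \<i>"
      using p by (auto simp: q_def path_def pathstart_def pathfinish_def exp_add fun_eq_iff intro!: continuous_intros)
    show "cx_map (T (exp \<circ> p)) (on_sections (\<lambda>z w. Mu z w - w) A (pathstart p)) =
      on_sections (\<lambda>z w. Mu z w - w) A (pathfinish p)"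
      using flat_sectionD[OF H_inf_flat[OF A] p] flat_sectionD[OF H_inf_flat[OF A] q(1)]
      unfolding q by (simp add: on_sections_def eq vec.linear_diff[OF transport_clinear[OF p]]
        vec.linear_scale[OF transport_clinear[OF p]])
  next
    show "on_sections (\<lambda>z w. Mu z w - w) A \<xi> \<in> eigenspace (Ms (exp \<xi>)) c" for \<xi>
      unfolding on_sections_def
      by (intro vec.subspace_diff subspace_eigenspace Ms_clinear exp_not_eq_zero Mu_eigenspace H_inf_eigenspace A)
  qed
  have "on_sections (\<lambda>z. fps_op (fps_ln 1) (\<lambda>w. Mu z w - w)) A \<in> H_inf T Ms c"
    by (rule on_sections_fps_op[OF unipotent_minus_id[OF Mu_unipotent] Mu A])
  then show "on_sections N A \<in> H_inf T Ms c"
    by (simp add: on_sections_def op_log_eq_fps_op Mu_unipotent)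
qed

lemma G_sec_eq: "G_sec N \<alpha> A = on_sections (NF (Gamma_fps \<alpha>)) A"
  by (simp add: G_sec_def on_sections_def op_Gamma_eq_fps_op nilpotent_N Gamma_fps_def fun_eq_iff)

lemma op_exp_es:
  assumes "z \<noteq> 0"
  shows "op_exp (\<lambda>v. L *s (a *s v - (1 / (2 * of_real pi * \<i>)) *s N z v)) w =
     exp (L * a) *s NF (fps_exp (- L / (2 * of_real pi * \<i>))) z w"
proof -
  let ?X = "\<lambda>v. (- L / (2 * of_real pi * \<i>)) *s N z v"
  have "op_exp (\<lambda>v. L *s (a *s v - (1 / (2 * of_real pi * \<i>)) *s N z v)) w = op_exp (\<lambda>v. (L * a) *s v + ?X v) w"
    by (simp add: vec.scale_right_diff_distrib)
  also have "\<dots> = exp (L * a) *s op_exp ?X w"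
    by (rule op_exp_scalar_plus_nilpotent[OF nilpotent_op_scaled[OF nilpotent_N[OF assms]]])
  also have "op_exp ?X w = NF (fps_exp (- L / (2 * of_real pi * \<i>))) z w"
    unfolding op_exp_eq_fps_op fps_op_scaled[OF nilpotent_N[OF assms]] by simp
  finally show ?thesis .
qed

text \<open>
  The elementary section at \<open>e\<^sup>\<zeta>\<close>, computed with the branch \<open>\<zeta>\<close> of the logarithm.
\<close>

definition es_branch :: "(complex \<Rightarrow> complex^'n) \<Rightarrow> real \<Rightarrow> complex \<Rightarrow> complex^'n" where
  "es_branch A \<alpha> \<zeta> = exp (\<zeta> * of_real \<alpha>) *s NF (fps_exp (- \<zeta> / (2 * of_real pi * \<i>))) (exp \<zeta>) (A \<zeta>)"

text \<open>
  Passing to the next branch multiplies \<open>A\<close> by \<open>M = exp(-2 \<pi> i \<alpha>) exp(N)\<close>, which is exactly what the change of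
  \<open>exp(\<zeta> (\<alpha> - N / (2 \<pi> i)))\<close> undoes.
\<close>

lemma es_branch_periodic:
  assumes A: "A \<in> H_inf T Ms (exp (- 2 * of_real pi * \<i> * of_real \<alpha>))"
  shows "es_branch A \<alpha> (\<zeta> + 2 * of_real pi * \<i>) = es_branch A \<alpha> \<zeta>"
proof -
  let ?p = "2 * of_real pi * \<i>"
  note nil = nilpotent_N[OF exp_not_eq_zero[of \<zeta>]]
  have e: "exp (\<zeta> + ?p) = exp \<zeta>" by (simp add: exp_add)
  have "- (\<zeta> + ?p) / ?p = - \<zeta> / ?p + (- 1)" by (simp add: field_simps)
  then have "NF (fps_exp (- (\<zeta> + ?p) / ?p)) (exp \<zeta>) (NF (fps_exp 1) (exp \<zeta>) (A \<zeta>)) =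
      NF (fps_exp (- \<zeta> / ?p)) (exp \<zeta>) (A \<zeta>)"
    by (simp flip: fps_op_mult[OF nil] fps_exp_add_mult)
  moreover have "exp ((\<zeta> + ?p) * of_real \<alpha>) * exp (- 2 * of_real pi * \<i> * of_real \<alpha>) = exp (\<zeta> * of_real \<alpha>)"
    by (simp flip: exp_add add: algebra_simps)
  ultimately show ?thesis
    unfolding es_branch_def monodromy_H_inf[OF A] e vec.linear_scale[OF clinear_fps_op[OF nil]]
      vec.scale_scale by simp
qed

lemma es_eq_es_branch:
  assumes A: "A \<in> H_inf T Ms (exp (- 2 * of_real pi * \<i> * of_real \<alpha>))"
  shows "es N A \<alpha> (exp \<zeta>) = es_branch A \<alpha> \<zeta>"
proof -
  let ?p = "2 * of_real pi * \<i>"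
  have per: "es_branch A \<alpha> (\<zeta> + of_int n * ?p) = es_branch A \<alpha> \<zeta>" for n \<zeta>
  proof (induction n rule: int_induct[where k = 0])
    case (step1 i)
    then show ?case using es_branch_periodic[OF A, of "\<zeta> + of_int i * ?p"] by (simp add: algebra_simps)
  next
    case (step2 i)
    then show ?case using es_branch_periodic[OF A, of "\<zeta> + of_int (i - 1) * ?p"] by (simp add: algebra_simps)
  qed simp
  obtain n :: int where n: "Ln (exp \<zeta>) = \<zeta> + of_int (2 * n) * of_real pi * \<i>"
    using exp_eq[of "Ln (exp \<zeta>)" \<zeta>] by auto
  have "es N A \<alpha> (exp \<zeta>) = es_branch A \<alpha> (Ln (exp \<zeta>))"
    unfolding es_def es_branch_def by (subst op_exp_es) simp_all
  also have "\<dots> = es_branch A \<alpha> \<zeta>"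
    unfolding n using per[of \<zeta> n] by (simp only: of_int_mult of_int_numeral mult_ac)
  finally show ?thesis .
qed

end

section \<open>The Fourier-Laplace transformation of an elementary section\<close>

lemma bounded_linear_scale_vector: "bounded_linear (\<lambda>c. c *s (v :: complex^'m))"
  unfolding linear_conv_bounded_linear[symmetric]
  by (rule linearI) (simp_all add: vec_eq_iff algebra_simps)

lemma set_integral_scale_vector:
  fixes v :: "complex^'m"
  assumes "set_integrable M X g"
  shows "set_integrable M X (\<lambda>t. g t *s v)" and "(LINT t:X|M. g t *s v) = (LINT t:X|M. g t) *s v"
proof -
  have eq: "indicator X t *\<^sub>R (g t *s v) = (indicator X t *\<^sub>R g t) *s v" for t
    by (simp add: vec_eq_iff)
  note int = assms[unfolded set_integrable_def]
  show "set_integrable M X (\<lambda>t. g t *s v)"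
    unfolding set_integrable_def eq
    by (rule integrable_bounded_linear[OF bounded_linear_scale_vector int])
  show "(LINT t:X|M. g t *s v) = (LINT t:X|M. g t) *s v"
    unfolding set_lebesgue_integral_def eq
    by (rule integral_bounded_linear[OF bounded_linear_scale_vector int])
qed

text \<open>
  A segment of the ray through \<open>z\<close> is the exponential of a path of logarithms. So parallel transport
  along it can be computed on multivalued sections.
\<close>

lemma linepath_ray_eq_exp:
  assumes t: "t > 0" and z: "z \<noteq> 0"
  defines "q \<equiv> \<lambda>s::real. Ln z + of_real (ln ((1 - s) * t + s))"
  shows "path q" and "homotopic_paths (- {0}) (exp \<circ> q) (linepath (of_real t * z) z)"
    and "pathstart q = Ln z + of_real (ln t)" and "pathfinish q = Ln z"
proof -
  have pos: "(1 - s) * t + s > 0" if "s \<in> {0..1}" for s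
    using that t by (cases "s = 1") (auto intro!: add_pos_nonneg)
  show q: "path q"
    unfolding path_def q_def by (intro continuous_intros) (use pos in fastforce)
  show "homotopic_paths (- {0}) (exp \<circ> q) (linepath (of_real t * z) z)"
  proof (rule homotopic_paths_eq)
    show "path (exp \<circ> q)" "path_image (exp \<circ> q) \<subseteq> - {0}" using path_exp_comp[OF q] by auto
    show "(exp \<circ> q) s = linepath (of_real t * z) z s" if "s \<in> {0..1}" for s
    proof -
      have "(exp \<circ> q) s = z * of_real ((1 - s) * t + s)"
        using pos[OF that] z unfolding q_def o_def exp_add exp_of_real by simp
      then show ?thesis by (simp add: linepath_def scaleR_conv_of_real algebra_simps)
    qed
  qed
  show "pathstart q = Ln z + of_real (ln t)" "pathfinish q = Ln z"
    by (simp_all add: q_def pathstart_def pathfinish_def)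
qed

lemma fps_nth_Gamma_fps:
  "fps_nth (Gamma_fps \<alpha>) k = (- 1 / (2 * of_real pi * \<i>)) ^ k / fact k * (deriv ^^ k) Gamma (of_real \<alpha>)"
  unfolding Gamma_fps_def fps_nth_compose_linear by (simp add: fps_expansion_def)

context flat_bundle_jordan
begin

lemma FL_integrand_es:
  assumes A: "A \<in> H_inf T Ms (exp (- 2 * of_real pi * \<i> * of_real \<alpha>))"
    and t: "t > 0" and z: "z \<noteq> 0"
  shows "FL_integrand T (es N A (\<alpha> - 1)) z t =
    (exp (Ln z * of_real \<alpha>) * of_real (exp (- t) * t powr (\<alpha> - 1))) *s
      NF (fps_exp (- (Ln z + of_real (ln t)) / (2 * of_real pi * \<i>))) z (A (Ln z))"
proof -
  let ?\<xi> = "Ln z + of_real (ln t)"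
  let ?F = "fps_exp (- ?\<xi> / (2 * of_real pi * \<i>))"
  \<comment> \<open>the eigenvalue depends on \<open>\<alpha>\<close> only modulo \<open>1\<close>, so that \<open>es N A (\<alpha> - 1)\<close> is an elementary section\<close>
  have c: "exp (- 2 * of_real pi * \<i> * of_real (\<alpha> - 1)) = exp (- 2 * of_real pi * \<i> * of_real \<alpha>)"
  proof -
    have "- 2 * of_real pi * \<i> * of_real (\<alpha> - 1) = - 2 * of_real pi * \<i> * of_real \<alpha> + 2 * of_real pi * \<i>"
      by (simp add: algebra_simps)
    then show ?thesis by (simp only: exp_add exp_two_pi_i mult_1_right)
  qed
  have e: "exp ?\<xi> = of_real t * z" using t z by (simp add: exp_add exp_of_real)
  obtain q where q: "path q" "homotopic_paths (- {0}) (exp \<circ> q) (linepath (of_real t * z) z)"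
    "pathstart q = ?\<xi>" "pathfinish q = Ln z"
    using linepath_ray_eq_exp[OF t z] by blast
  have "T (linepath (of_real t * z) z) = T (exp \<circ> q)"
    using flat q(2) unfolding flat_bundle_def by metis
  moreover have "cx_map (T (exp \<circ> q)) (es N A (\<alpha> - 1) (of_real t * z)) =
      exp (?\<xi> * of_real (\<alpha> - 1)) *s NF ?F z (A (Ln z))"
  proof -
    have "es N A (\<alpha> - 1) (of_real t * z) = exp (?\<xi> * of_real (\<alpha> - 1)) *s on_sections (NF ?F) A ?\<xi>"
      unfolding e[symmetric] by (subst es_eq_es_branch[OF A[folded c]]) (simp add: es_branch_def on_sections_def)
    moreover have "cx_map (T (exp \<circ> q)) (on_sections (NF ?F) A ?\<xi>) = on_sections (NF ?F) A (Ln z)"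
      using flat_sectionD[OF H_inf_flat[OF on_sections_NF[OF exp_not_eq_zero A]] q(1)] unfolding q .
    ultimately show ?thesis
      using z by (simp add: vec.linear_scale[OF transport_clinear[OF q(1)]] on_sections_def)
  qed
  moreover have "exp (- (of_real t * z) / z) * z * exp (?\<xi> * of_real (\<alpha> - 1)) =
      exp (Ln z * of_real \<alpha>) * of_real (exp (- t) * t powr (\<alpha> - 1))"
  proof -
    have "t powr (\<alpha> - 1) = exp (ln t * (\<alpha> - 1))" using t by (simp add: powr_def mult.commute)
    then have powr: "of_real (t powr (\<alpha> - 1)) = exp (of_real (ln t) * of_real (\<alpha> - 1) :: complex)"
      by (simp only: exp_of_real of_real_mult[symmetric])
    have "exp (Ln z) * exp (?\<xi> * of_real (\<alpha> - 1)) =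
        exp (Ln z * of_real \<alpha>) * exp (of_real (ln t) * of_real (\<alpha> - 1))"
      by (simp flip: exp_add add: algebra_simps)
    then have "z * exp (?\<xi> * of_real (\<alpha> - 1)) = exp (Ln z * of_real \<alpha>) * of_real (t powr (\<alpha> - 1))"
      unfolding exp_Ln[OF z] powr .
    moreover have "exp (- (of_real t * z) / z) = of_real (exp (- t))"
      using z by (simp flip: exp_of_real)
    ultimately show ?thesis by (simp only: of_real_mult mult.assoc mult.left_commute[of "of_real (exp (- t))"])
  qed
  ultimately show ?thesis by (simp add: FL_integrand_def Let_def)
qed

lemma FL_es:
  assumes \<alpha>: "\<alpha> > 0" and A: "A \<in> H_inf T Ms (exp (- 2 * of_real pi * \<i> * of_real \<alpha>))"
    and z: "z \<noteq> 0"
  shows "set_integrable lborel {0<..} (FL_integrand T (es N A (\<alpha> - 1)) z)"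
    and "FL T (es N A (\<alpha> - 1)) z = es N (G_sec N \<alpha> A) \<alpha> z"
proof -
  define \<kappa> where "\<kappa> = - 1 / (2 * of_real pi * \<i>)"
  let ?R = "NF (fps_exp (- Ln z / (2 * of_real pi * \<i>))) z"
  let ?a = "A (Ln z)"
  note nil = nilpotent_N[OF z]
  note R = clinear_fps_op[OF nil, of "fps_exp (- Ln z / (2 * of_real pi * \<i>))"]
  obtain K where K: "\<And>F v. NF F z v = (\<Sum>k<K. fps_nth F k *s (N z ^^ k) v)"
    by (rule nilpotent_opE[OF nil], rule that)
  define g where "g k t = complex_of_real (exp (- t) * t powr (\<alpha> - 1) * ln t ^ k)" for k t
  define u where "u k = exp (Ln z * of_real \<alpha>) *s ?R ((\<kappa> ^ k / fact k) *s (N z ^^ k) ?a)" for k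
  have integrand: "FL_integrand T (es N A (\<alpha> - 1)) z t = (\<Sum>k<K. g k t *s u k)" if t: "t > 0" for t
  proof -
    let ?F = "fps_exp (- (Ln z + of_real (ln t)) / (2 * of_real pi * \<i>))"
    have "?F = fps_exp (- Ln z / (2 * of_real pi * \<i>)) * fps_exp (\<kappa> * of_real (ln t))"
      by (simp flip: fps_exp_add_mult add: \<kappa>_def diff_divide_distrib)
    then have "NF ?F z ?a = ?R (\<Sum>k<K. ((\<kappa> * of_real (ln t)) ^ k / fact k) *s (N z ^^ k) ?a)"
      by (simp only: fps_op_mult[OF nil]) (simp only: K[of "fps_exp (\<kappa> * of_real (ln t))"] fps_exp_nth of_nat_fact)
    also have "\<dots> = (\<Sum>k<K. of_real (ln t ^ k) *s ?R ((\<kappa> ^ k / fact k) *s (N z ^^ k) ?a))"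
      unfolding vec.linear_sum[OF R] vec.linear_scale[OF R]
      by (simp add: power_mult_distrib mult_ac)
    finally show ?thesis
      unfolding FL_integrand_es[OF A t z] u_def g_def
      by (simp add: vec.scale_sum_right mult_ac)
  qed
  have g: "set_integrable lborel {0<..} (g k)"
    "(LINT t:{0<..}|lborel. g k t) = (deriv ^^ k) Gamma (of_real \<alpha>)" for k
    unfolding g_def using Gamma_higher_deriv_integral[OF \<alpha>] by auto
  note gu = set_integral_scale_vector[OF g(1)]
  have int: "set_integrable lborel {0<..} (\<lambda>t. \<Sum>k<K. g k t *s u k)"
    unfolding set_integrable_def scaleR_sum_right
    by (intro Bochner_Integration.integrable_sum gu(1)[unfolded set_integrable_def])
  show "set_integrable lborel {0<..} (FL_integrand T (es N A (\<alpha> - 1)) z)"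
    by (rule set_integrable_cong[THEN iffD1, OF _ _ _ int]) (simp_all add: integrand)
  have "FL T (es N A (\<alpha> - 1)) z = (LINT t:{0<..}|lborel. \<Sum>k<K. g k t *s u k)"
    unfolding FL_def by (rule set_lebesgue_integral_cong) (simp_all add: integrand)
  also have "\<dots> = (\<Sum>k<K. LINT t:{0<..}|lborel. g k t *s u k)"
    unfolding set_lebesgue_integral_def scaleR_sum_right
    by (intro Bochner_Integration.integral_sum gu(1)[unfolded set_integrable_def])
  also have "\<dots> = (\<Sum>k<K. (deriv ^^ k) Gamma (of_real \<alpha>) *s u k)"
    by (simp add: gu(2) g(2))
  also have "\<dots> = exp (Ln z * of_real \<alpha>) *s ?R (NF (Gamma_fps \<alpha>) z ?a)"
    unfolding K[of "Gamma_fps \<alpha>"] u_def vec.linear_sum[OF R] vec.linear_scale[OF R] fps_nth_Gamma_fps \<kappa>_def[symmetric]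
    by (simp add: vec.scale_sum_right mult_ac)
  also have "\<dots> = es_branch (G_sec N \<alpha> A) \<alpha> (Ln z)"
    using z by (simp add: es_branch_def G_sec_eq on_sections_def)
  also have "\<dots> = es N (G_sec N \<alpha> A) \<alpha> z"
    using es_eq_es_branch[of "G_sec N \<alpha> A" \<alpha> "Ln z"] on_sections_NF[OF _ A] z
    by (simp add: G_sec_eq)
  finally show "FL T (es N A (\<alpha> - 1)) z = es N (G_sec N \<alpha> A) \<alpha> z" .
qed

end

section \<open>The pairing of elementary sections\<close>

lemma cx_form_add:
  assumes "bilinear s"
  shows "cx_form s (a + a') b = cx_form s a b + cx_form s a' b"
    and "cx_form s b (a + a') = cx_form s b a + cx_form s b a'"
  by (simp_all add: cx_form_def Re_Im_vec_add bilinear_ladd[OF assms] bilinear_radd[OF assms] complex_eq_iff)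

lemma cx_form_scale:
  assumes "bilinear s"
  shows "cx_form s (c *s a) b = c * cx_form s a b" and "cx_form s b (c *s a) = c * cx_form s b a"
  by (simp_all add: cx_form_def Re_Im_vec_scale bilinear_ladd[OF assms] bilinear_radd[OF assms]
      bilinear_lsub[OF assms] bilinear_rsub[OF assms] bilinear_lmul[OF assms] bilinear_rmul[OF assms]
      complex_eq_iff algebra_simps)

lemma cx_form_0:
  assumes "bilinear s"
  shows "cx_form s 0 b = 0" and "cx_form s b 0 = 0"
  using cx_form_scale[OF assms, where c = 0 and a = 0 and b = b] by simp_all

lemma cx_form_sum:
  assumes "bilinear s"
  shows "cx_form s (\<Sum>i\<in>I. f i) b = (\<Sum>i\<in>I. cx_form s (f i) b)"
    and "cx_form s b (\<Sum>i\<in>I. f i) = (\<Sum>i\<in>I. cx_form s b (f i))"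
  by (induction I rule: infinite_finite_induct) (simp_all add: cx_form_0[OF assms] cx_form_add[OF assms])

lemma cx_form_diff:
  assumes "bilinear s"
  shows "cx_form s (a - a') b = cx_form s a b - cx_form s a' b"
    and "cx_form s b (a - a') = cx_form s b a - cx_form s b a'"
  using cx_form_add(1)[OF assms, of "a - a'" a' b] cx_form_add(2)[OF assms, of b "a - a'" a'] by simp_all

lemma cx_form_cx_map:
  assumes "\<And>a b. s' (f a) (f b) = s a b"
  shows "cx_form s' (cx_map f a) (cx_map f b) = cx_form s a b"
proof -
  have "Re_vec (cx_map f a) = f (Re_vec a)" "Im_vec (cx_map f a) = f (Im_vec a)" for a
    by (simp_all add: Re_vec_def Im_vec_def cx_map_def vec_eq_iff)
  then show ?thesis by (simp add: cx_form_def assms)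
qed

text \<open>
  Since \<open>V\<close> and \<open>W\<close> are invariant, adjointness passes to powers by induction, and then to finite sums.
\<close>

lemma cx_form_fps_op_adjoint:
  assumes s: "bilinear s" and X: "nilpotent_op X" and Z: "nilpotent_op Z"
    and V: "\<And>a. a \<in> V \<Longrightarrow> X a \<in> V" and W: "\<And>b. b \<in> W \<Longrightarrow> Z b \<in> W"
    and adj: "\<And>a b. a \<in> V \<Longrightarrow> b \<in> W \<Longrightarrow> cx_form s (X a) b = cx_form s a (Z b)"
    and a: "a \<in> V" and b: "b \<in> W"
  shows "cx_form s (fps_op F X a) b = cx_form s a (fps_op F Z b)"
proof -
  have pow: "cx_form s ((X ^^ k) a) b = cx_form s a ((Z ^^ k) b)" for k
    using b
  proof (induction k arbitrary: b)
    case (Suc k)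
    have "(X ^^ k) a \<in> V" by (induction k) (use a V in auto)
    then have "cx_form s ((X ^^ Suc k) a) b = cx_form s ((X ^^ k) a) (Z b)" using adj Suc.prems by simp
    also have "\<dots> = cx_form s a ((Z ^^ Suc k) b)"
      using Suc.IH[OF W[OF Suc.prems]] by (simp add: funpow_swap1)
    finally show ?case .
  qed simp
  obtain K1 where K1: "\<And>v. (X ^^ K1) v = 0" by (rule nilpotent_opE[OF X], rule that)
  obtain K2 where K2: "\<And>v. (Z ^^ K2) v = 0" by (rule nilpotent_opE[OF Z], rule that)
  have K: "(X ^^ max K1 K2) a = 0" "(Z ^^ max K1 K2) b = 0"
    by (rule funpow_eq_0_mono[OF nilpotent_op_clinear[OF X] K1], simp)
       (rule funpow_eq_0_mono[OF nilpotent_op_clinear[OF Z] K2], simp)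
  show ?thesis
    unfolding fps_op_eq_sum[OF nilpotent_op_clinear[OF X] K(1)] fps_op_eq_sum[OF nilpotent_op_clinear[OF Z] K(2)]
    by (simp add: cx_form_sum[OF s] cx_form_scale[OF s] pow)
qed

lemma fps_ln_compose_exp_neg: "fps_ln 1 oo (fps_exp (- 1) - 1) = (- fps_X :: complex fps)"
proof -
  have "fps_exp (- 1) - 1 = (fps_exp 1 - 1 :: complex fps) oo (- fps_X)"
    by (simp add: fps_compose_sub_distrib)
  then have "fps_ln 1 oo (fps_exp (- 1) - 1) = (fps_ln 1 oo (fps_exp 1 - 1)) oo (- fps_X :: complex fps)"
    by (simp add: fps_compose_assoc)
  also have "fps_ln 1 oo (fps_exp 1 - 1) = (fps_X :: complex fps)"
    using fps_inv_fps_exp_compose(1)[of "1 :: complex"] by (simp add: fps_ln_fps_exp_inv)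
  finally show ?thesis by simp
qed

text \<open>
  The series \<open>h\<close> with \<open>\<nu>\<^bsup>-1\<^esup> = h(N)\<close> on the eigenspace of the semisimple part for \<open>c\<close>: it is \<open>c e\<^sup>n - 1\<close>, the
  series of \<open>M - id\<close>, for \<open>c \<noteq> 1\<close>, and \<open>-(e\<^sup>n - 1) / n\<close> for \<open>c = 1\<close>.
\<close>

definition seifert_fps :: "complex \<Rightarrow> complex fps" where
  "seifert_fps c = (if c = 1 then - Abs_fps (\<lambda>k. 1 / fact (Suc k)) else fps_const c * fps_exp 1 - 1)"

locale flat_bundle_form = flat_bundle_jordan T Ms Mu
  for T :: "(real \<Rightarrow> complex) \<Rightarrow> real^'n \<Rightarrow> real^'n" and Ms Mu +
  fixes m :: int and S :: "complex \<Rightarrow> real^'n \<Rightarrow> real^'n \<Rightarrow> real"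
    and \<nu> :: "complex \<Rightarrow> complex^'n \<Rightarrow> complex^'n"
  assumes form: "flat_form T Ms m S"
    and nu: "\<And>z. z \<noteq> 0 \<Longrightarrow> is_nu (monodromy T z) (N z) (\<nu> z)"
begin

lemma bilinear_S: "z \<noteq> 0 \<Longrightarrow> bilinear (S z)"
  using form[unfolded flat_form_def, THEN conjunct1] by blast

lemma S_transport:
  assumes "path p"
  shows "cx_form (S (exp (pathfinish p))) (cx_map (T (exp \<circ> p)) a) (cx_map (T (exp \<circ> p)) b) =
    cx_form (S (exp (pathstart p))) a b"
proof (rule cx_form_cx_map)
  fix a b
  have "pathfinish (exp \<circ> p) = exp (pathfinish p)" "pathstart (exp \<circ> p) = exp (pathstart p)"
    by (simp_all add: pathfinish_def pathstart_def)
  moreover have "S (pathfinish (exp \<circ> p)) (T (exp \<circ> p) a) (T (exp \<circ> p) b) = S (pathstart (exp \<circ> p)) a b"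
    using form[unfolded flat_form_def, THEN conjunct2, THEN conjunct2, THEN conjunct1] path_exp_comp[OF assms]
    by blast
  ultimately show "S (exp (pathfinish p)) (T (exp \<circ> p) a) (T (exp \<circ> p) b) = S (exp (pathstart p)) a b"
    by simp
qed

lemma S_monodromy:
  assumes "z \<noteq> 0"
  shows "cx_form (S z) (monodromy T z a) (monodromy T z b) = cx_form (S z) a b"
proof -
  define \<xi> where "\<xi> = Ln z"
  have z: "z = exp \<xi>" "exp (\<xi> + \<i> * of_real (2 * pi)) = exp \<xi>"
    using assms by (simp_all add: \<xi>_def exp_add mult_ac)
  show ?thesis
    using S_transport[of "linepath \<xi> (\<xi> + \<i> * of_real (2 * pi))" a b]
    unfolding monodromy_def flat_shift_def z(1) rotation_path_exp by (simp add: z(2) del: of_real_mult)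
qed

text \<open>
  By invariance under the monodromy and \<open>c c' = 1\<close>, the adjoint of \<open>M\<^sub>u = exp(N)\<close> is its inverse \<open>exp(-N)\<close>. Since \<open>N\<close> is
  the logarithm of \<open>M\<^sub>u\<close>, its adjoint is the logarithm of \<open>exp(-N)\<close>, which is \<open>-N\<close>.
\<close>

lemma S_NF_adjoint:
  assumes z: "z \<noteq> 0" and cc: "c * c' = 1"
    and a: "a \<in> eigenspace (Ms z) c" and b: "b \<in> eigenspace (Ms z) c'"
  shows "cx_form (S z) (NF F z a) b = cx_form (S z) a (NF (F oo - fps_X) z b)"
proof -
  note s = bilinear_S[OF z] and nil = nilpotent_N[OF z]
  let ?Y = "\<lambda>w. Mu z w - w" and ?Z = "fps_op (fps_exp (- 1) - 1) (N z)"
  note Y = unipotent_minus_id[OF Mu_unipotent[OF z]]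
  have Z: "nilpotent_op ?Z" by (rule nilpotent_op_fps_op[OF nil]) simp
  have Y_E: "?Y v \<in> eigenspace (Ms z) d" if "v \<in> eigenspace (Ms z) d" for v d
    by (intro vec.subspace_diff subspace_eigenspace Ms_clinear z Mu_eigenspace that)
  have adjY: "cx_form (S z) (?Y a) b = cx_form (S z) a (?Z b)"
    if a: "a \<in> eigenspace (Ms z) c" and b: "b \<in> eigenspace (Ms z) c'" for a b
  proof -
    \<comment> \<open>write \<open>b = exp(N) exp(-N) b\<close> to apply the invariance of \<open>S\<close> to \<open>a\<close> and \<open>exp(-N) b\<close>\<close>
    let ?b = "NF (fps_exp (- 1)) z b"
    have b': "?b \<in> eigenspace (Ms z) c'" by (rule NF_eigenspace[OF z b])
    have "Mu z ?b = b"
      by (simp add: Mu_eq_exp_N[OF z] flip: fps_op_mult[OF nil] fps_exp_add_mult)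
    then have "cx_form (S z) (Mu z a) b = cx_form (S z) (Mu z a) (Mu z ?b)" by simp
    also have "\<dots> = (c * c') * cx_form (S z) (Mu z a) (Mu z ?b)" by (simp add: cc)
    also have "\<dots> = cx_form (S z) (monodromy T z a) (monodromy T z ?b)"
      by (simp only: monodromy_eigenspace[OF z a] monodromy_eigenspace[OF z b'] Mu_eq_exp_N[OF z, symmetric]
          cx_form_scale[OF s] mult_ac)
    also have "\<dots> = cx_form (S z) a ?b" by (rule S_monodromy[OF z])
    finally show ?thesis by (simp add: cx_form_diff[OF s] fps_op_diff[OF nil])
  qed
  have adjN: "cx_form (S z) (N z a) b = cx_form (S z) a (NF (- fps_X) z b)"
    if "a \<in> eigenspace (Ms z) c" "b \<in> eigenspace (Ms z) c'" for a b
  proof -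
    have "cx_form (S z) (N z a) b = cx_form (S z) a (fps_op (fps_ln 1) ?Z b)"
      unfolding op_log_eq_fps_op[OF Mu_unipotent[OF z]]
      using cx_form_fps_op_adjoint[OF s Y Z Y_E NF_eigenspace[OF z] adjY that, of "fps_ln 1"]
      by (simp add: op_log_eq_fps_op[OF Mu_unipotent[OF z]])
    also have "fps_op (fps_ln 1) ?Z b = NF (- fps_X) z b"
      by (subst fps_op_compose[OF nil, symmetric]) (simp_all add: fps_ln_compose_exp_neg)
    finally show ?thesis .
  qed
  have "nilpotent_op (NF (- fps_X) z)" by (rule nilpotent_op_fps_op[OF nil]) simp
  from cx_form_fps_op_adjoint[OF s nil this _ NF_eigenspace[OF z] adjN a b, of F]
  have "cx_form (S z) (NF F z a) b = cx_form (S z) a (fps_op F (NF (- fps_X) z) b)"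
    using NF_eigenspace[OF z, of _ c fps_X] by simp
  then show ?thesis by (subst fps_op_compose[OF nil]) simp_all
qed

lemma nu_seifert_fps:
  assumes z: "z \<noteq> 0" and v: "v \<in> eigenspace (Ms z) c"
  shows "\<nu> z (NF (seifert_fps c) z v) = v"
proof -
  have G: "v \<in> gen_eigenspace (monodromy T z) c" using eigenspace_subset_gen_eigenspace[OF z] v by blast
  note nil = nilpotent_N[OF z]
  have lin: "clinear (\<nu> z)" using nu[OF z] by (simp add: is_nu_def)
  show ?thesis
  proof (cases "c = 1")
    case True
    have "NF (seifert_fps c) z v = - op_expm1_div (N z) v"
      using fps_op_diff[OF nil, of 0 "Abs_fps (\<lambda>k. 1 / fact (Suc k))" v] True
      by (simp add: seifert_fps_def op_expm1_div_eq_fps_op)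
    then show ?thesis using nu[OF z] G True unfolding is_nu_def
      by (simp add: vec.linear_neg[OF lin])
  next
    case False
    have "NF (seifert_fps c) z v = monodromy T z v - v"
      using False by (simp add: seifert_fps_def fps_op_diff[OF nil] fps_op_const_mult[OF nil] monodromy_eigenspace[OF z v])
    then show ?thesis using nu[OF z] G False unfolding is_nu_def by metis
  qed
qed

text \<open>
  The image of \<open>\<nu>\<close> contains every eigenspace of the semisimple part, and these span the fibre. So \<open>\<nu>\<close> is
  surjective, hence injective by finite dimension, and its inverse can be read off from the
  values that are known.
\<close>

lemma inv_nu:
  assumes z: "z \<noteq> 0" and v: "v \<in> eigenspace (Ms z) c"
  shows "inv (\<nu> z) v = NF (seifert_fps c) z v"
proof -
  have lin: "clinear (\<nu> z)" using nu[OF z] by (simp add: is_nu_def)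
  have "vec.span (\<Union>c. eigenspace (Ms z) c) \<subseteq> range (\<nu> z)"
  proof (rule vec.span_minimal)
    show "(\<Union>c. eigenspace (Ms z) c) \<subseteq> range (\<nu> z)" using nu_seifert_fps[OF z] by (metis UN_least rangeI subsetI)
    show "vec.subspace (range (\<nu> z))" by (rule vec.linear_subspace_image[OF lin vec.subspace_UNIV])
  qed
  then have "surj (\<nu> z)" using jordan[OF z] by (auto simp: jordan_parts_def semisimple_def)
  then have "inj (\<nu> z)" by (rule vec.linear_surj_imp_inj[OF lin])
  then show ?thesis using nu_seifert_fps[OF z v] by (metis inv_f_f)
qed

lemma L_nor_eigenspace:
  assumes "z \<noteq> 0" "b \<in> eigenspace (Ms z) c'"
  shows "L_nor S \<nu> z a b = - cx_form (S z) a (NF (seifert_fps c') z b)"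
  by (simp add: L_nor_def inv_nu[OF assms])

text \<open>
  If \<open>\<zeta>\<close> is a logarithm of \<open>z\<close>, then \<open>\<zeta> + \<pi> i\<close> is one of \<open>-z\<close>, and the shift \<open>\<gamma>\<^bsub>-\<pi>\<^esub>\<close> leads from there back to \<open>\<zeta>\<close>. The
  additional \<open>\<pi> i\<close> contributes \<open>exp(\<pi> i \<beta>) exp(-N/2)\<close>, while the factors \<open>exp(-\<zeta> N / (2 \<pi> i))\<close> cancel because \<open>N\<close> is skew.
\<close>

lemma P_pair_es:
  assumes A: "A \<in> H_inf T Ms (exp (- 2 * of_real pi * \<i> * of_real \<alpha>))" (is "A \<in> H_inf T Ms ?c")
    and B: "B \<in> H_inf T Ms (exp (- 2 * of_real pi * \<i> * of_real \<beta>))" (is "B \<in> H_inf T Ms ?c'")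
    and sum: "\<alpha> + \<beta> \<in> \<int>" and \<zeta>: "exp \<zeta> = z"
  shows "P_pair T S \<nu> m z (es N A \<alpha> z) (es N B \<beta> (- z)) =
    exp (\<zeta> * of_real (\<alpha> + \<beta>)) / (2 * of_real pi * \<i>) powi (m + 1) * exp (of_real pi * \<i> * of_real \<beta>) *
      L_nor S \<nu> z (A \<zeta>) (op_exp (\<lambda>v. (- 1 / 2) *s N z v) (B \<zeta>))"
proof -
  have z: "z \<noteq> 0" using \<zeta> by auto
  note nil = nilpotent_N[OF z] and s = bilinear_S[OF z]
  have cc: "?c * ?c' = 1"
  proof -
    obtain k :: int where "\<alpha> + \<beta> = of_int k" using sum by (auto elim: Ints_cases)
    then have "complex_of_real \<alpha> + of_real \<beta> = of_int k" by (metis of_real_add of_real_of_int_eq)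
    moreover have "?c * ?c' = exp (- (2 * of_real pi * \<i> * (of_real \<alpha> + of_real \<beta>)))"
      by (simp flip: exp_add add: algebra_simps)
    moreover have "exp ((2 * of_int (- k) * of_real pi) * \<i>) = (1 :: complex)"
      unfolding exp_eq_1 by (auto intro!: exI[of _ "- k"])
    ultimately show ?thesis by (simp add: mult_ac)
  qed
  have E: "A \<zeta> \<in> eigenspace (Ms z) ?c" "B \<zeta> \<in> eigenspace (Ms z) ?c'"
    using H_inf_eigenspace[OF A, of \<zeta>] H_inf_eigenspace[OF B, of \<zeta>] by (simp_all add: \<zeta>)
  let ?\<eta> = "\<zeta> + \<i> * of_real pi"
  let ?e = "fps_exp (- \<zeta> / (2 * of_real pi * \<i>))" and ?h = "fps_exp (- 1 / 2) :: complex fps"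
  have \<eta>: "exp ?\<eta> = - z" by (simp add: exp_add \<zeta> mult.commute[of \<i>])
  have e: "fps_exp (- ?\<eta> / (2 * of_real pi * \<i>)) = ?e * ?h"
    by (simp flip: fps_exp_add_mult add: diff_divide_distrib)
  have es_A: "es N A \<alpha> z = exp (\<zeta> * of_real \<alpha>) *s NF ?e z (A \<zeta>)"
    using es_eq_es_branch[OF A, of \<zeta>] by (simp add: \<zeta> es_branch_def)
  have es_B: "flat_shift T (- z) (- pi) (es N B \<beta> (- z)) = exp (?\<eta> * of_real \<beta>) *s NF (?e * ?h) z (B \<zeta>)"
  proof -
    have lin: "clinear (flat_shift T (exp ?\<eta>) (- pi))"
      unfolding flat_shift_def rotation_path_exp by (rule transport_clinear) simp
    have "flat_shift T (exp ?\<eta>) (- pi) (on_sections (NF (?e * ?h)) B ?\<eta>) = on_sections (NF (?e * ?h)) B \<zeta>"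
      using flat_shift_flat_section[OF H_inf_flat[OF on_sections_NF[OF exp_not_eq_zero B]], of ?\<eta> "- pi"] by simp
    moreover have "es N B \<beta> (- z) = exp (?\<eta> * of_real \<beta>) *s on_sections (NF (?e * ?h)) B ?\<eta>"
      using es_eq_es_branch[OF B, of ?\<eta>] unfolding \<eta> es_branch_def e on_sections_def .
    ultimately show ?thesis
      using vec.linear_scale[OF lin] by (simp add: \<eta> on_sections_def \<zeta>)
  qed
  have E': "NF F z (B \<zeta>) \<in> eigenspace (Ms z) ?c'" for F by (rule NF_eigenspace[OF z E(2)])
  have "L_nor S \<nu> z (es N A \<alpha> z) (flat_shift T (- z) (- pi) (es N B \<beta> (- z))) =
      - (exp (\<zeta> * of_real \<alpha>) * exp (?\<eta> * of_real \<beta>)) *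
        cx_form (S z) (NF ?e z (A \<zeta>)) (NF (seifert_fps ?c') z (NF (?e * ?h) z (B \<zeta>)))"
    unfolding es_A es_B
    by (subst L_nor_eigenspace[OF z vec.subspace_scale[OF subspace_eigenspace[OF Ms_clinear[OF z]] E']])
       (simp add: vec.linear_scale[OF clinear_fps_op[OF nil]] cx_form_scale[OF s])
  also have "cx_form (S z) (NF ?e z (A \<zeta>)) (NF (seifert_fps ?c') z (NF (?e * ?h) z (B \<zeta>))) =
      cx_form (S z) (A \<zeta>) (NF ((?e oo - fps_X) * (seifert_fps ?c' * (?e * ?h))) z (B \<zeta>))"
    unfolding fps_op_mult[OF nil, of "?e oo - fps_X"] fps_op_mult[OF nil, of "seifert_fps ?c'", symmetric]
    by (rule S_NF_adjoint[OF z cc E(1) E'])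
  also have "(?e oo - fps_X) * (seifert_fps ?c' * (?e * ?h)) = ((?e oo - fps_X) * ?e) * (seifert_fps ?c' * ?h)"
    by (simp only: mult_ac)
  also have "(?e oo - fps_X) * ?e = 1"
    by (simp flip: fps_exp_add_mult)
  also have "cx_form (S z) (A \<zeta>) (NF (1 * (seifert_fps ?c' * ?h)) z (B \<zeta>)) =
      - L_nor S \<nu> z (A \<zeta>) (NF ?h z (B \<zeta>))"
    by (simp add: L_nor_eigenspace[OF z E'] fps_op_mult[OF nil])
  also have "NF ?h z (B \<zeta>) = op_exp (\<lambda>v. (- 1 / 2) *s N z v) (B \<zeta>)"
    unfolding op_exp_eq_fps_op fps_op_scaled[OF nil] by simp
  also have "exp (\<zeta> * of_real \<alpha>) * exp (?\<eta> * of_real \<beta>) =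
      exp (\<zeta> * of_real (\<alpha> + \<beta>)) * exp (of_real pi * \<i> * of_real \<beta>)"
    by (simp flip: exp_add add: algebra_simps)
  finally show ?thesis by (simp add: P_pair_def)
qed

text \<open>
  Moving \<open>G\<^bsup>(\<alpha>)\<^esup>\<close> to the second argument collects all operators into one power series in \<open>N\<close>, which a
  reflection formula reduces to a scalar.
\<close>

lemma L_nor_Gamma:
  assumes A: "A \<in> H_inf T Ms c" and B: "B \<in> H_inf T Ms c'" and cc: "c * c' = 1" and \<zeta>: "exp \<zeta> = z"
    and reflection: "(Gamma_fps \<alpha> oo - fps_X) * (Gamma_fps \<beta> * fps_exp (- 1 / 2) * seifert_fps c') = fps_const \<kappa>"
  shows "L_nor S \<nu> z (G_sec N \<alpha> A \<zeta>) (op_exp (\<lambda>v. (- 1 / 2) *s N z v) (G_sec N \<beta> B \<zeta>)) =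
    - \<kappa> * cx_form (S z) (A \<zeta>) (B \<zeta>)"
proof -
  have z: "z \<noteq> 0" using \<zeta> by auto
  note nil = nilpotent_N[OF z] and s = bilinear_S[OF z]
  have E: "A \<zeta> \<in> eigenspace (Ms z) c" "B \<zeta> \<in> eigenspace (Ms z) c'"
    using H_inf_eigenspace[OF A, of \<zeta>] H_inf_eigenspace[OF B, of \<zeta>] by (simp_all add: \<zeta>)
  have "op_exp (\<lambda>v. (- 1 / 2) *s N z v) (G_sec N \<beta> B \<zeta>) = NF (fps_exp (- 1 / 2)) z (NF (Gamma_fps \<beta>) z (B \<zeta>))"
    unfolding op_exp_eq_fps_op fps_op_scaled[OF nil] by (simp add: G_sec_eq on_sections_def \<zeta>)
  moreover have "G_sec N \<alpha> A \<zeta> = NF (Gamma_fps \<alpha>) z (A \<zeta>)" by (simp add: G_sec_eq on_sections_def \<zeta>)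
  ultimately have "L_nor S \<nu> z (G_sec N \<alpha> A \<zeta>) (op_exp (\<lambda>v. (- 1 / 2) *s N z v) (G_sec N \<beta> B \<zeta>)) =
     - cx_form (S z) (NF (Gamma_fps \<alpha>) z (A \<zeta>))
        (NF (seifert_fps c' * (fps_exp (- 1 / 2) * Gamma_fps \<beta>)) z (B \<zeta>))"
    by (simp add: L_nor_eigenspace[OF z NF_eigenspace[OF z NF_eigenspace[OF z E(2)]]] fps_op_mult[OF nil])
  also have "\<dots> = - cx_form (S z) (A \<zeta>)
      (NF ((Gamma_fps \<alpha> oo - fps_X) * (seifert_fps c' * (fps_exp (- 1 / 2) * Gamma_fps \<beta>))) z (B \<zeta>))"
    by (subst S_NF_adjoint[OF z cc E(1) NF_eigenspace[OF z E(2)]]) (simp only: fps_op_mult[OF nil])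
  also have "(Gamma_fps \<alpha> oo - fps_X) * (seifert_fps c' * (fps_exp (- 1 / 2) * Gamma_fps \<beta>)) = fps_const \<kappa>"
    unfolding reflection[symmetric] by (simp only: mult_ac)
  finally show ?thesis by (simp add: cx_form_scale[OF s])
qed

lemma form_on_sections_eq:
  assumes A: "A \<in> flat_sections T" and B: "B \<in> flat_sections T"
  shows "form_on_sections S A B = cx_form (S (exp \<zeta>)) (A \<zeta>) (B \<zeta>)"
  unfolding form_on_sections_def
proof (rule the_equality)
  show "\<forall>\<xi>. cx_form (S (exp \<xi>)) (A \<xi>) (B \<xi>) = cx_form (S (exp \<zeta>)) (A \<zeta>) (B \<zeta>)"
  proof
    fix \<xi>
    show "cx_form (S (exp \<xi>)) (A \<xi>) (B \<xi>) = cx_form (S (exp \<zeta>)) (A \<zeta>) (B \<zeta>)"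
      using S_transport[of "linepath \<zeta> \<xi>" "A \<zeta>" "B \<zeta>"] flat_sectionD[OF A, of "linepath \<zeta> \<xi>"]
        flat_sectionD[OF B, of "linepath \<zeta> \<xi>"] by simp
  qed
qed (erule allE[of _ \<zeta>], simp)

end

section \<open>The pairing of Fourier-Laplace transforms\<close>

theorem theorem5p2:
  fixes m :: int
    and T :: "(real \<Rightarrow> complex) \<Rightarrow> real^'n \<Rightarrow> real^'n"
    and Ms Mu N \<nu> :: "complex \<Rightarrow> complex^'n \<Rightarrow> complex^'n"
    and S :: "complex \<Rightarrow> real^'n \<Rightarrow> real^'n \<Rightarrow> real"
  assumes flat: "flat_bundle T"
    and eigenvalues: "\<And>z c. z \<noteq> 0 \<Longrightarrow> eigenspace (monodromy T z) c \<noteq> {0} \<Longrightarrow> norm c = 1"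
    and jordan: "\<And>z. z \<noteq> 0 \<Longrightarrow> jordan_parts (monodromy T z) (Ms z) (Mu z)"
    and log: "N = (\<lambda>z. op_log (Mu z))"
    and form: "flat_form T Ms m S"
    and nu: "\<And>z. z \<noteq> 0 \<Longrightarrow> is_nu (monodromy T z) (N z) (\<nu> z)"
  shows
    "(\<forall>\<alpha> A. \<alpha> > 0 \<and> A \<in> H_inf T Ms (exp (- 2 * of_real pi * \<i> * of_real \<alpha>)) \<longrightarrow>
        G_sec N \<alpha> A \<in> H_inf T Ms (exp (- 2 * of_real pi * \<i> * of_real \<alpha>)) \<and>
        (\<forall>z. z \<noteq> 0 \<longrightarrow>
           set_integrable lborel {0<..} (FL_integrand T (es N A (\<alpha> - 1)) z) \<and>
           FL T (es N A (\<alpha> - 1)) z = es N (G_sec N \<alpha> A) \<alpha> z)) \<and>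
     (\<forall>\<alpha> A B z \<zeta>. 0 < \<alpha> \<and> \<alpha> < 1 \<and>
        A \<in> H_inf T Ms (exp (- 2 * of_real pi * \<i> * of_real \<alpha>)) \<and>
        B \<in> H_inf T Ms (exp (2 * of_real pi * \<i> * of_real \<alpha>)) \<and> exp \<zeta> = z \<longrightarrow>
        P_pair T S \<nu> m z (es N (G_sec N \<alpha> A) \<alpha> z) (es N (G_sec N (1 - \<alpha>) B) (1 - \<alpha>) (- z)) =
          z / (2 * of_real pi * \<i>) powi (m + 1) * exp (of_real pi * \<i> * of_real (1 - \<alpha>)) *
            L_nor S \<nu> z (G_sec N \<alpha> A \<zeta>) (op_exp (\<lambda>v. (- 1 / 2) *s N z v) (G_sec N (1 - \<alpha>) B \<zeta>)) \<and>
        z / (2 * of_real pi * \<i>) powi (m + 1) * exp (of_real pi * \<i> * of_real (1 - \<alpha>)) *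
            L_nor S \<nu> z (G_sec N \<alpha> A \<zeta>) (op_exp (\<lambda>v. (- 1 / 2) *s N z v) (G_sec N (1 - \<alpha>) B \<zeta>)) =
          z / (2 * of_real pi * \<i>) powi m * form_on_sections S A B) \<and>
     (\<forall>A B z \<zeta>. A \<in> H_inf T Ms 1 \<and> B \<in> H_inf T Ms 1 \<and> exp \<zeta> = z \<longrightarrow>
        P_pair T S \<nu> m z (es N (G_sec N 1 A) 1 z) (es N (G_sec N 1 B) 1 (- z)) =
          - z\<^sup>2 / (2 * of_real pi * \<i>) powi (m + 1) *
            L_nor S \<nu> z (G_sec N 1 A \<zeta>) (op_exp (\<lambda>v. (- 1 / 2) *s N z v) (G_sec N 1 B \<zeta>)) \<and>
        - z\<^sup>2 / (2 * of_real pi * \<i>) powi (m + 1) *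
            L_nor S \<nu> z (G_sec N 1 A \<zeta>) (op_exp (\<lambda>v. (- 1 / 2) *s N z v) (G_sec N 1 B \<zeta>)) =
          - z\<^sup>2 / (2 * of_real pi * \<i>) powi (m + 1) * form_on_sections S A B)"
proof -
  interpret flat_bundle_form T Ms Mu m S \<nu>
    by unfold_locales (fact flat jordan form nu[unfolded log])+
  have G_H: "G_sec N \<alpha> A \<in> H_inf T Ms c" if "A \<in> H_inf T Ms c" "c \<noteq> 0" for \<alpha> A c
    using on_sections_NF[OF that(2,1)] by (simp add: log G_sec_eq)
  have one: "exp (- 2 * of_real pi * \<i> * of_real 1) = (1 :: complex)"
    unfolding exp_eq_1 by (auto intro!: exI[of _ "- 1"])
  show ?thesis
  proof (intro conjI allI impI; elim conjE)
    fix \<alpha> A assume "\<alpha> > 0" "A \<in> H_inf T Ms (exp (- 2 * of_real pi * \<i> * of_real \<alpha>))"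
    then show "G_sec N \<alpha> A \<in> H_inf T Ms (exp (- 2 * of_real pi * \<i> * of_real \<alpha>))"
      by (simp add: G_H)
  next
    fix \<alpha> A z assume "\<alpha> > 0" "A \<in> H_inf T Ms (exp (- 2 * of_real pi * \<i> * of_real \<alpha>))" "z \<noteq> (0 :: complex)"
    note FL = FL_es[OF this]
    from FL(1) show "set_integrable lborel {0<..} (FL_integrand T (es N A (\<alpha> - 1)) z)" by (simp only: log)
    from FL(2) show "FL T (es N A (\<alpha> - 1)) z = es N (G_sec N \<alpha> A) \<alpha> z" by (simp only: log)
  next
    fix \<alpha> A B and z \<zeta> :: complex
    assume \<alpha>: "0 < \<alpha>" "\<alpha> < 1" and A: "A \<in> H_inf T Ms (exp (- 2 * of_real pi * \<i> * of_real \<alpha>))"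
      and B: "B \<in> H_inf T Ms (exp (2 * of_real pi * \<i> * of_real \<alpha>))" and \<zeta>: "exp \<zeta> = z"
    have c': "exp (2 * of_real pi * \<i> * of_real \<alpha>) = exp (- 2 * of_real pi * \<i> * of_real (1 - \<alpha>))"
    proof -
      have "2 * of_real pi * \<i> * of_real \<alpha> =
          - 2 * of_real pi * \<i> * of_real (1 - \<alpha>) + 2 * of_real pi * \<i>"
        by (simp add: algebra_simps)
      then show ?thesis by (simp only: exp_add exp_two_pi_i mult_1_right)
    qed
    have "P_pair T S \<nu> m z (es N (G_sec N \<alpha> A) \<alpha> z) (es N (G_sec N (1 - \<alpha>) B) (1 - \<alpha>) (- z)) =
        exp (\<zeta> * of_real (\<alpha> + (1 - \<alpha>))) / (2 * of_real pi * \<i>) powi (m + 1) *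
          exp (of_real pi * \<i> * of_real (1 - \<alpha>)) *
          L_nor S \<nu> z (G_sec N \<alpha> A \<zeta>) (op_exp (\<lambda>v. (- 1 / 2) *s N z v) (G_sec N (1 - \<alpha>) B \<zeta>))"
      unfolding log
      by (rule P_pair_es[OF G_H[OF A, unfolded log] G_H[OF B[unfolded c'], unfolded log] _ \<zeta>]) simp_all
    then show "P_pair T S \<nu> m z (es N (G_sec N \<alpha> A) \<alpha> z) (es N (G_sec N (1 - \<alpha>) B) (1 - \<alpha>) (- z)) =
          z / (2 * of_real pi * \<i>) powi (m + 1) * exp (of_real pi * \<i> * of_real (1 - \<alpha>)) *
            L_nor S \<nu> z (G_sec N \<alpha> A \<zeta>) (op_exp (\<lambda>v. (- 1 / 2) *s N z v) (G_sec N (1 - \<alpha>) B \<zeta>))"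
      by (simp add: \<zeta>)
    have cc: "exp (- 2 * of_real pi * \<i> * of_real \<alpha>) * exp (2 * of_real pi * \<i> * of_real \<alpha>) = (1 :: complex)"
      by (simp flip: exp_add)
    have "exp (2 * of_real pi * \<i> * of_real \<alpha>) \<noteq> (1 :: complex)"
    proof
      assume "exp (2 * of_real pi * \<i> * of_real \<alpha>) = (1 :: complex)"
      then obtain n :: int where "\<alpha> = of_int n" by (auto simp: exp_eq_1)
      then show False using \<alpha> by simp
    qed
    then have "(Gamma_fps \<alpha> oo - fps_X) * (Gamma_fps (1 - \<alpha>) * fps_exp (- 1 / 2) *
        seifert_fps (exp (2 * of_real pi * \<i> * of_real \<alpha>))) =
        fps_const (2 * of_real pi * \<i> * exp (of_real pi * \<i> * of_real \<alpha>))"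
      using Gamma_fps_reflection[OF \<alpha>] by (simp add: seifert_fps_def)
    note L = L_nor_Gamma[OF A B cc \<zeta> this]
    have S: "form_on_sections S A B = cx_form (S z) (A \<zeta>) (B \<zeta>)"
      using form_on_sections_eq[OF H_inf_flat[OF A] H_inf_flat[OF B], of \<zeta>] by (simp add: \<zeta>)
    have "exp (of_real pi * \<i> * of_real (1 - \<alpha>)) * exp (of_real pi * \<i> * of_real \<alpha>) = - (1 :: complex)"
    proof -
      have "of_real pi * \<i> * of_real (1 - \<alpha>) + of_real pi * \<i> * of_real \<alpha> = of_real pi * \<i>"
        by (simp add: algebra_simps)
      then show ?thesis by (simp flip: exp_add)
    qed
    then have e: "exp (of_real pi * \<i> * of_real (1 - \<alpha>)) * (- (2 * of_real pi * \<i> * exp (of_real pi * \<i> * of_real \<alpha>)) * x) =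
        2 * of_real pi * \<i> * x" for x
      by algebra
    have p: "(2 * of_real pi * \<i>) powi (m + 1) = (2 * of_real pi * \<i>) powi m * (2 * of_real pi * \<i>)"
      by (simp add: power_int_add_1)
    show "z / (2 * of_real pi * \<i>) powi (m + 1) * exp (of_real pi * \<i> * of_real (1 - \<alpha>)) *
            L_nor S \<nu> z (G_sec N \<alpha> A \<zeta>) (op_exp (\<lambda>v. (- 1 / 2) *s N z v) (G_sec N (1 - \<alpha>) B \<zeta>)) =
          z / (2 * of_real pi * \<i>) powi m * form_on_sections S A B"
      unfolding log L S mult.assoc[of _ "exp (of_real pi * \<i> * of_real (1 - \<alpha>))"] e p by simp
  next
    fix A B and z \<zeta> :: complex
    assume A: "A \<in> H_inf T Ms 1" and B: "B \<in> H_inf T Ms 1" and \<zeta>: "exp \<zeta> = z"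
    have "exp (\<zeta> * of_real (1 + 1)) = z\<^sup>2"
      by (simp flip: \<zeta> exp_double add: mult.commute)
    moreover have "exp (of_real pi * \<i> * of_real 1) = (- 1 :: complex)" by simp
    moreover have "P_pair T S \<nu> m z (es N (G_sec N 1 A) 1 z) (es N (G_sec N 1 B) 1 (- z)) =
        exp (\<zeta> * of_real (1 + 1)) / (2 * of_real pi * \<i>) powi (m + 1) * exp (of_real pi * \<i> * of_real 1) *
          L_nor S \<nu> z (G_sec N 1 A \<zeta>) (op_exp (\<lambda>v. (- 1 / 2) *s N z v) (G_sec N 1 B \<zeta>))"
      unfolding log
      by (rule P_pair_es[unfolded one, OF _ _ _ \<zeta>]) (simp_all add: G_H[unfolded log] A B one[simplified])
    ultimately show "P_pair T S \<nu> m z (es N (G_sec N 1 A) 1 z) (es N (G_sec N 1 B) 1 (- z)) =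
          - z\<^sup>2 / (2 * of_real pi * \<i>) powi (m + 1) *
            L_nor S \<nu> z (G_sec N 1 A \<zeta>) (op_exp (\<lambda>v. (- 1 / 2) *s N z v) (G_sec N 1 B \<zeta>))"
      by simp
    have "(Gamma_fps 1 oo - fps_X) * (Gamma_fps 1 * fps_exp (- 1 / 2) * seifert_fps 1) = fps_const (- 1)"
      using Gamma_fps_reflection_1 by (simp add: seifert_fps_def)
    note L = L_nor_Gamma[OF A B _ \<zeta> this]
    show "- z\<^sup>2 / (2 * of_real pi * \<i>) powi (m + 1) *
            L_nor S \<nu> z (G_sec N 1 A \<zeta>) (op_exp (\<lambda>v. (- 1 / 2) *s N z v) (G_sec N 1 B \<zeta>)) =
          - z\<^sup>2 / (2 * of_real pi * \<i>) powi (m + 1) * form_on_sections S A B"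
      using L form_on_sections_eq[OF H_inf_flat[OF A] H_inf_flat[OF B], of \<zeta>] by (simp add: \<zeta> log)
  qed
qed

end
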